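(* Let $1<\alpha<2$, let $A$ generate an $\alpha$-times resolvent family $\{S_\alpha(t)\}_{t\ge0}$ on a Banach space $X$, and let $r>0$. Then the function $$u(t)=S_\alpha(t)x+\int_0^tS_\alpha(s)y\,ds+(P_\alpha*f)(t),\qquad t\in[0,r],$$ is a strong solution of $\mathbf D_t^\alpha u(t)=Au(t)+f(t)$, $t\in[0,r]$, $u(0)=x$, $u'(0)=y$, for every pair $x,y\in D(A)$ and every $f\in C([0,r];X)$ if and only if $S_\alpha(\cdot)$ is of bounded semivariation on $[0,r]$.
   Context: For $\beta>0$ let $g_\beta(t)=\frac{t^{\beta-1}}{\Gamma(\beta)}$ for $t>0$, and $(g_\beta*f)(t)=\int_0^tg_\beta(t-s)f(s)\,ds$. Let $A$ be a closed, densely defined linear operator on $X$. A family $\{S_\alpha(t)\}_{t\ge0}$ of bounded operators is an $\alpha$-times resolvent family generated by $A$ if: (i) it is strongly continuous on $[0,\infty)$ with $S_\alpha(0)=I$; (ii) $S_\alpha(t)D(A)\subset D(A)$ and $AS_\alpha(t)x=S_\alpha(t)Ax$ for $x\in D(A)$; (iii) $S_\alpha(t)x=x+(g_\alpha*S_\alpha)(t)Ax$ for $x\in D(A)$, $t\ge0$. Define $P_\alpha(t)x=\int_0^tg_{\alpha-1}(t-s)S_\alpha(s)x\,ds$ and $(P_\alpha*f)(t)=\int_0^tP_\alpha(t-s)f(s)\,ds$. The Caputo derivative is $\mathbf D_t^\alpha u(t)=\frac{d^2}{dt^2}\big(g_{2-\alpha}*(u-x-\cdot\,y)\big)(t)$.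 A strong solution of $\mathbf D_t^\alpha u=Au+f$ on $[0,r]$, $u(0)=x$, $u'(0)=y$, is $u\in C([0,r];D(A))\cap C^1([0,r];X)$ with $u(0)=x$, $u'(0)=y$, $g_{2-\alpha}*(u(\cdot)-x-\cdot\,y)\in C^2([0,r];X)$ and $\mathbf D_t^\alpha u(t)=Au(t)+f(t)$ for all $t\in[0,r]$. For $G:[a,b]\to B(X)$ and a subdivision $d: a=d_0<d_1<\dots<d_n=b$, let $SV_d[G]=\sup\{\|\sum_{i=1}^n[G(d_i)-G(d_{i-1})]x_i\|: x_i\in X,\ \|x_i\|\le1\}$ and $SV[G]=\sup_d SV_d[G]$ over all subdivisions; $G$ is of bounded semivariation on $[a,b]$ if $SV[G]<\infty$. *)

theory Defs
  imports "HOL-Analysis.Analysis"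
begin

definition gk :: "real \<Rightarrow> real \<Rightarrow> real" where
  "gk \<beta> t = (if t > 0 then t powr (\<beta> - 1) / Gamma \<beta> else 0)"

definition gconv :: "real \<Rightarrow> (real \<Rightarrow> 'a::real_normed_vector) \<Rightarrow> real \<Rightarrow> 'a" where
  "gconv \<beta> f t = integral {0..t} (\<lambda>s. gk \<beta> (t - s) *\<^sub>R f s)"

definition closed_dense_op :: "'a::real_normed_vector set \<Rightarrow> ('a \<Rightarrow> 'a) \<Rightarrow> bool" where
  "closed_dense_op D A \<longleftrightarrow>
     subspace D \<and>
     (\<forall>x\<in>D. \<forall>y\<in>D. A (x + y) = A x + A y) \<and>
     (\<forall>x\<in>D. \<forall>c. A (c *\<^sub>R x) = c *\<^sub>R A x) \<and>
     closed {(x, A x) | x. x \<in> D} \<and>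
     closure D = UNIV"

definition resolvent_family ::
  "'a::real_normed_vector set \<Rightarrow> ('a \<Rightarrow> 'a) \<Rightarrow> real \<Rightarrow> (real \<Rightarrow> 'a \<Rightarrow>\<^sub>L 'a) \<Rightarrow> bool" where
  "resolvent_family D A \<alpha> S \<longleftrightarrow>
     (\<forall>x. continuous_on {0..} (\<lambda>t. blinfun_apply (S t) x)) \<and>
     S 0 = id_blinfun \<and>
     (\<forall>t\<ge>0. \<forall>x\<in>D. S t x \<in> D \<and> A (S t x) = S t (A x)) \<and>
     (\<forall>t\<ge>0. \<forall>x\<in>D. S t x = x + gconv \<alpha> (\<lambda>s. S s (A x)) t)"

definition Pop :: "real \<Rightarrow> (real \<Rightarrow> 'a::real_normed_vector \<Rightarrow>\<^sub>L 'a) \<Rightarrow> real \<Rightarrow> 'a \<Rightarrow> 'a" where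
  "Pop \<alpha> S t x = gconv (\<alpha> - 1) (\<lambda>s. S s x) t"

definition Pconv :: "real \<Rightarrow> (real \<Rightarrow> 'a::real_normed_vector \<Rightarrow>\<^sub>L 'a) \<Rightarrow> (real \<Rightarrow> 'a) \<Rightarrow> real \<Rightarrow> 'a" where
  "Pconv \<alpha> S f t = integral {0..t} (\<lambda>s. Pop \<alpha> S (t - s) (f s))"

text \<open>Strong solution of the Caputo problem D^alpha u = A u + f on [0,r], u(0)=x, u'(0)=y.
  Derivatives are one-sided at the endpoints (within [0,r]).  The Caputo derivative
  is the second derivative v2 of v = g_(2-alpha) * (u - x - . y).\<close>
definition strong_solution ::
  "'a::real_normed_vector set \<Rightarrow> ('a \<Rightarrow> 'a) \<Rightarrow> real \<Rightarrow> real \<Rightarrow> (real \<Rightarrow> 'a)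
    \<Rightarrow> 'a \<Rightarrow> 'a \<Rightarrow> (real \<Rightarrow> 'a) \<Rightarrow> bool" where
  "strong_solution D A \<alpha> r f x y u \<longleftrightarrow>
     (\<forall>t\<in>{0..r}. u t \<in> D) \<and>
     continuous_on {0..r} u \<and> continuous_on {0..r} (\<lambda>t. A (u t)) \<and>
     (\<exists>u'. (\<forall>t\<in>{0..r}. (u has_vector_derivative u' t) (at t within {0..r})) \<and>
           continuous_on {0..r} u' \<and> u 0 = x \<and> u' 0 = y) \<and>
     (\<exists>v1 v2.
        (\<forall>t\<in>{0..r}.
           (gconv (2 - \<alpha>) (\<lambda>s. u s - x - s *\<^sub>R y) has_vector_derivative v1 t) (at t within {0..r}) \<and>
           (v1 has_vector_derivative v2 t) (at t within {0..r})) \<and>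
        continuous_on {0..r} v2 \<and>
        (\<forall>t\<in>{0..r}. v2 t = A (u t) + f t))"

definition subdivision :: "real \<Rightarrow> real \<Rightarrow> (nat \<Rightarrow> real) \<Rightarrow> nat \<Rightarrow> bool" where
  "subdivision a b d n \<longleftrightarrow> d 0 = a \<and> d n = b \<and> (\<forall>i<n. d i < d (Suc i))"

definition SV_d :: "(real \<Rightarrow> 'a::real_normed_vector \<Rightarrow>\<^sub>L 'a) \<Rightarrow> (nat \<Rightarrow> real) \<Rightarrow> nat \<Rightarrow> ereal" where
  "SV_d G d n = (SUP xs \<in> {xs. \<forall>i. norm (xs i) \<le> 1}.
      ereal (norm (\<Sum>i\<in>{1..n}. blinfun_apply (G (d i) - G (d (i - 1))) (xs i))))"

definition SV :: "(real \<Rightarrow> 'a::real_normed_vector \<Rightarrow>\<^sub>L 'a) \<Rightarrow> real \<Rightarrow> real \<Rightarrow> ereal" where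
  "SV G a b = (SUP dn \<in> {(d, n). subdivision a b d n}. SV_d G (fst dn) (snd dn))"

definition bounded_semivariation :: "(real \<Rightarrow> 'a::real_normed_vector \<Rightarrow>\<^sub>L 'a) \<Rightarrow> real \<Rightarrow> real \<Rightarrow> bool" where
  "bounded_semivariation G a b \<longleftrightarrow> SV G a b < \<infinity>"

end

theory Submission
  imports Defs
begin

text \<open>
  Write Q = g_\<alpha> * S. Closedness and density give A Q(t) = S(t) - I on the whole space, so A maps a
  Riemann sum of P * f to a sum over increments of S.

  If S has bounded semivariation, this yields a bound of A (P * f) by the supremum of f whenever
  P * f takes values in D. For monomials f the identity P * f = g_\<alpha> * h with h = A (P * f) + f follows from
  the semigroup law of the kernels g_\<beta>, and the bound extends it to all continuous f, because
  polynomials are dense. A function x + t y + g_\<alpha> * h is then seen to be a strong solution.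

  Conversely, solvability with zero initial data puts (P * f)(r) in D for all continuous f. On D the
  operator A is the strong limit of bounded multiples of S(h) - I, so the uniform boundedness
  principle bounds A (P * f)(r) by the supremum of f. Letting f tend to step functions bounds the
  semivariation of S.
\<close>

text \<open>The obstacle is that \<open>A\<close> cannot simply be pulled through the limit of the
  Riemann sums: their images stay bounded by the semivariation, but no convergence of these images
  is at hand, so closedness does not put P * f into \<open>D\<close>. Hence the estimate is proved a
  priori, with membership in \<open>D\<close> as a hypothesis. It survives the limit because each
  \<open>Aapprox h\<close> is a bounded operator and norm (Aapprox h p) \<le> M * norm (A p) holds
  on \<open>D\<close> with one M for all h in (0,1]. Membership is explicit for monomials, and the
  estimate makes the Caputo derivatives of approximating solutions a Cauchy sequence. The kernels
  g_(\<alpha>-1) and g_(2-\<alpha>) are singular. A substitution turns each convolution into an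
  average of a continuous function, and the semigroup law is obtained by density of polynomials
  rather than by exchanging singular integrals. Writing solutions as x + t y + g_\<alpha> * H makes
  regularity in time automatic: splitting g_\<alpha> = g_1 * g_(\<alpha>-1) gives u', and
  g_(2-\<alpha>) * g_\<alpha> = g_2 gives the Caputo derivative.\<close>

section \<open>Uniform boundedness\<close>

text \<open>Sokal's gliding hump: one of x + \<xi>, x - \<xi> is mapped to a vector at least as long as T \<xi>.\<close>

lemma blinfun_large_value_near:
  fixes T :: "'a::real_normed_vector \<Rightarrow>\<^sub>L 'b::real_normed_vector"
  assumes "0 < \<rho>"
  shows "\<exists>y. norm (y - x) \<le> \<rho> \<and> 2/3 * \<rho> * norm T \<le> norm (T y)"
proof (cases "T = 0")
  case True
  then show ?thesis using assms by (intro exI[of _ x]) simp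
next
  case False
  \<comment> \<open>Any factor below 1 could be reached here; the gliding hump below needs one above
    1/2.\<close>
  have "\<exists>z. norm (T z) > 2/3 * norm T * norm z"
  proof (rule ccontr)
    assume "\<not> ?thesis"
    then have "norm (T z) \<le> 2/3 * norm T * norm z" for z by (simp add: not_less)
    then have "norm T \<le> 2/3 * norm T" by (intro norm_blinfun_bound) auto
    then show False using False by simp
  qed
  then obtain z where z: "norm (T z) > 2/3 * norm T * norm z" by blast
  then have "z \<noteq> 0" by auto
  define \<xi> where "\<xi> = (\<rho> / norm z) *\<^sub>R z"
  have \<xi>: "norm \<xi> = \<rho>" using \<open>z \<noteq> 0\<close> assms by (simp add: \<xi>_def)
  have "2/3 * \<rho> * norm T \<le> norm (T \<xi>)"
    using z \<open>z \<noteq> 0\<close> assms by (simp add: \<xi>_def blinfun.scaleR_right field_simps)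
  also have "\<dots> \<le> max (norm (T (x + \<xi>))) (norm (T (x - \<xi>)))"
  proof -
    have "2 *\<^sub>R T \<xi> = T (x + \<xi>) - T (x - \<xi>)"
      by (simp add: blinfun.add_right blinfun.diff_right scaleR_2)
    then have "2 * norm (T \<xi>) \<le> norm (T (x + \<xi>)) + norm (T (x - \<xi>))"
      by (metis norm_scaleR abs_numeral norm_triangle_ineq4)
    then show ?thesis by linarith
  qed
  finally have "2/3 * \<rho> * norm T \<le> norm (T (x + \<xi>)) \<or> 2/3 * \<rho> * norm T \<le> norm (T (x - \<xi>))"
    by linarith
  then show ?thesis
  proof
    assume "2/3 * \<rho> * norm T \<le> norm (T (x + \<xi>))"
    then show ?thesis using \<xi> by (intro exI[of _ "x + \<xi>"]) simp
  next
    assume "2/3 * \<rho> * norm T \<le> norm (T (x - \<xi>))"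
    then show ?thesis using \<xi> by (intro exI[of _ "x - \<xi>"]) simp
  qed
qed

text \<open>If norm (U n) > 4 ^ n, moves of length at most 1 / 3 ^ n towards large values of U n
  converge to a point l, and norm (U n l) still grows like (4/3) ^ n.\<close>

theorem uniform_boundedness_principle:
  fixes T :: "'i \<Rightarrow> 'a::banach \<Rightarrow>\<^sub>L 'b::real_normed_vector"
  assumes bdd: "\<And>x. \<exists>K. \<forall>i\<in>I. norm (T i x) \<le> K"
  shows "\<exists>K. \<forall>i\<in>I. norm (T i) \<le> K"
proof (rule ccontr)
  assume "\<not> ?thesis"
  then have "\<forall>K. \<exists>i\<in>I. K < norm (T i)" by (meson not_le)
  then obtain j where j: "\<And>K. j K \<in> I" "\<And>K. K < norm (T (j K))" by metis
  define U where "U n = T (j (4 ^ n))" for n :: nat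
  have U: "4 ^ n < norm (U n)" for n using j by (simp add: U_def)
  obtain Y where Y: "\<And>n x. norm (Y n x - x) \<le> 1 / 3 ^ n"
      "\<And>n x. 2/3 * (1 / 3 ^ n) * norm (U n) \<le> norm (U n (Y n x))"
  proof -
    have "\<forall>n x. \<exists>y. norm (y - x) \<le> 1 / 3 ^ n \<and> 2/3 * (1 / 3 ^ n) * norm (U n) \<le> norm (U n y)"
      by (intro allI blinfun_large_value_near) simp
    then show ?thesis using that by metis
  qed
  define X where "X = rec_nat 0 (\<lambda>n. Y (Suc n))"
  have X: "X (Suc n) = Y (Suc n) (X n)" for n by (simp add: X_def)
  have step: "norm (X (Suc n) - X n) \<le> (1/3) ^ Suc n" for n
    using Y(1)[of "Suc n" "X n"] by (simp add: X power_divide)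
  have sm: "summable (\<lambda>n. X (Suc n) - X n)"
    by (rule summable_comparison_test'[where N = 0 and g = "\<lambda>n. (1/3) ^ Suc n"])
       (use step in \<open>auto intro: summable_mult summable_geometric\<close>)
  define l where "l = (\<Sum>n. X (Suc n) - X n) + X 0"
  \<comment> \<open>All later moves together have length at most half of 1 / 3 ^ n, which costs less
    than the factor 2/3 gained at the n-th move.\<close>
  have tail: "norm (l - X n) \<le> (1/3) ^ n / 2" for n
  proof -
    have "(\<Sum>k<n. X (Suc k) - X k) = X n - X 0" by (rule sum_lessThan_telescope)
    then have "l - X n = (\<Sum>k. X (Suc (k + n)) - X (k + n))"
      using suminf_split_initial_segment[OF sm, of n] by (simp add: l_def)
    also have "norm \<dots> \<le> (\<Sum>k. (1/3) ^ Suc n * (1/3) ^ k)"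
    proof (rule norm_suminf_le)
      fix k show "norm (X (Suc (k + n)) - X (k + n)) \<le> (1/3) ^ Suc n * (1/3) ^ k"
        using step[of "k + n"] by (simp add: power_add ac_simps)
    qed (intro summable_mult summable_geometric, simp)
    also have "\<dots> = (1/3) ^ n / 2"
      by (subst suminf_mult) (auto simp: suminf_geometric summable_geometric)
    finally show ?thesis .
  qed
  obtain K where K: "\<And>i. i \<in> I \<Longrightarrow> norm (T i l) \<le> K" using bdd by blast
  \<comment> \<open>The margin 2/3 - 1/2 = 1/6 is the source of the factor 6.\<close>
  have *: "(4/3) ^ n \<le> 6 * K" if n: "0 < n" for n
  proof -
    obtain m where m: "n = Suc m" using n by (cases n) auto
    have "2/3 * ((1/3) ^ n * norm (U n)) \<le> norm (U n (X n))"
      using Y(2)[of n "X m"] by (simp add: m X power_divide)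
    moreover have "norm (U n (X n)) \<le> norm (U n l) + norm (U n (l - X n))"
      using norm_triangle_ineq4[of "U n l" "U n (l - X n)"] by (simp add: blinfun.diff_right)
    moreover have "norm (U n (l - X n)) \<le> norm (U n) * ((1/3) ^ n / 2)"
      using norm_blinfun[of "U n" "l - X n"] tail[of n] by (meson mult_left_mono norm_ge_zero order_trans)
    then have "norm (U n (l - X n)) \<le> ((1/3) ^ n * norm (U n)) / 2" by (simp add: mult.commute)
    moreover have "norm (U n l) \<le> K" using K j by (simp add: U_def)
    ultimately have "(1/3) ^ n * norm (U n) \<le> 6 * K" by linarith
    moreover have "(1/3) ^ n * 4 ^ n \<le> (1/3) ^ n * norm (U n)"
      using U[of n] by (intro mult_left_mono) auto
    ultimately show ?thesis by (simp add: power_mult_distrib[symmetric])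
  qed
  obtain n where "6 * K < (4/3) ^ n" using real_arch_pow[of "4/3" "6 * K"] by auto
  also have "\<dots> \<le> (4/3) ^ Suc n" by (rule power_increasing) auto
  finally show False using *[of "Suc n"] by simp
qed

section \<open>Density of polynomials\<close>

text \<open>This is the variance of the mean of n Bernoulli trials. The square is expanded in 1, k
  and k (k - 1), whose Bernstein sums have closed forms.\<close>

lemma Bernstein_second_moment:
  assumes "0 < n"
  shows "(\<Sum>k\<le>n. (x - real k / real n)\<^sup>2 * Bernstein n k x) = x * (1 - x) / real n"
proof -
  have "(x - real k / real n)\<^sup>2 * Bernstein n k x =
      x\<^sup>2 * Bernstein n k x + (1 / real n ^ 2 - 2 * x / real n) * (real k * Bernstein n k x)
      + 1 / real n ^ 2 * (real k * (real k - 1) * Bernstein n k x)" for k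
    using assms by (simp add: field_simps power2_eq_square)
  then have "(\<Sum>k\<le>n. (x - real k / real n)\<^sup>2 * Bernstein n k x) =
      x\<^sup>2 + (1 / real n ^ 2 - 2 * x / real n) * (real n * x)
      + 1 / real n ^ 2 * (real n * (real n - 1) * x\<^sup>2)"
    by (simp add: sum.distrib flip: sum_distrib_left sum_divide_distrib)
  also have "\<dots> = x * (1 - x) / real n"
    using assms by (simp add: field_simps power2_eq_square)
  finally show ?thesis .
qed

text \<open>Bernstein's proof by Chebyshev's inequality carries over to vector values: only the
  coefficients f (k/n) are vectors, while the weights stay scalar, nonnegative and of sum 1.\<close>

lemma Bernstein_uniform_limit:
  fixes f :: "real \<Rightarrow> 'a::real_normed_vector"
  assumes f: "continuous_on {0..1} f"
  shows "uniform_limit {0..1} (\<lambda>n x. \<Sum>k\<le>n. Bernstein n k x *\<^sub>R f (real k / real n)) f sequentially"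
proof (rule uniform_limitI)
  fix e :: real assume e: "0 < e"
  have "bounded (f ` {0..1})"
    using compact_continuous_image[OF f] compact_imp_bounded by blast
  then obtain M where M: "0 < M" "\<And>x. x \<in> {0..1} \<Longrightarrow> norm (f x) \<le> M"
    by (force simp: bounded_pos)
  have "uniformly_continuous_on {0..1} f"
    using compact_uniformly_continuous[OF f] by simp
  then obtain d where d: "0 < d"
    "\<And>x y. x \<in> {0..1} \<Longrightarrow> y \<in> {0..1} \<Longrightarrow> dist y x < d \<Longrightarrow> dist (f y) (f x) < e / 2"
    using e unfolding uniformly_continuous_on_def by (metis half_gt_zero)
  \<comment> \<open>Chosen so that the variance term 2 M / (d^2 n) falls below e / 2.\<close>
  obtain N :: nat where N: "4 * M / (d\<^sup>2 * e) < real N" using reals_Archimedean2 by blast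
  show "\<forall>\<^sub>F n in sequentially. \<forall>x\<in>{0..1}.
      dist (\<Sum>k\<le>n. Bernstein n k x *\<^sub>R f (real k / real n)) (f x) < e"
  proof (rule eventually_sequentiallyI[of "Suc N"], rule ballI)
    fix n and x :: real assume n: "Suc N \<le> n" and x: "x \<in> {0..1}"
    then have n0: "0 < n" by simp
    \<comment> \<open>One bound for both cases: near x, uniform continuity gives e / 2; far from x,
      (x - k/n)^2 / d^2 is at least 1 and the trivial bound 2 M suffices.\<close>
    have pt: "norm (f (real k / real n) - f x) \<le> e / 2 + 2 * M / d\<^sup>2 * (x - real k / real n)\<^sup>2"
      if k: "k \<le> n" for k
    proof -
      have kn: "real k / real n \<in> {0..1}" using k n0 by simp
      show ?thesis
      proof (cases "dist (real k / real n) x < d")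
        case True
        then have "norm (f (real k / real n) - f x) < e / 2"
          using d(2)[OF x kn] by (simp add: dist_norm)
        also have "\<dots> \<le> e / 2 + 2 * M / d\<^sup>2 * (x - real k / real n)\<^sup>2" using M d by simp
        finally show ?thesis by simp
      next
        case False
        then have "d \<le> \<bar>x - real k / real n\<bar>" by (simp add: dist_norm abs_minus_commute)
        then have "d\<^sup>2 \<le> (x - real k / real n)\<^sup>2" using d(1) by (metis abs_ge_zero less_imp_le power2_abs power_mono)
        then have "2 * M * 1 \<le> 2 * M * ((x - real k / real n)\<^sup>2 / d\<^sup>2)"
          using M d by (intro mult_left_mono) auto
        moreover have "norm (f (real k / real n) - f x) \<le> M + M"
          using M(2)[OF kn] M(2)[OF x] norm_triangle_ineq4[of "f (real k / real n)" "f x"] by linarith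
        ultimately show ?thesis using e by simp
      qed
    qed
    have "(\<Sum>k\<le>n. Bernstein n k x *\<^sub>R f (real k / real n)) - f x
        = (\<Sum>k\<le>n. Bernstein n k x *\<^sub>R (f (real k / real n) - f x))"
      by (simp add: scaleR_diff_right sum_subtractf flip: scaleR_sum_left)
    also have "norm \<dots> \<le> (\<Sum>k\<le>n. (e / 2 + 2 * M / d\<^sup>2 * (x - real k / real n)\<^sup>2) * Bernstein n k x)"
    proof (rule sum_norm_le)
      fix k assume "k \<in> {..n}"
      then show "norm (Bernstein n k x *\<^sub>R (f (real k / real n) - f x))
          \<le> (e / 2 + 2 * M / d\<^sup>2 * (x - real k / real n)\<^sup>2) * Bernstein n k x"
        using mult_right_mono[OF pt[of k], of "Bernstein n k x"] x Bernstein_nonneg[of x n k]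
        by (simp add: mult.commute)
    qed
    also have "\<dots> = e / 2 * (\<Sum>k\<le>n. Bernstein n k x)
        + 2 * M / d\<^sup>2 * (\<Sum>k\<le>n. (x - real k / real n)\<^sup>2 * Bernstein n k x)"
      unfolding sum_distrib_left sum.distrib[symmetric] by (rule sum.cong) (auto simp: algebra_simps)
    also have "\<dots> = e / 2 + 2 * M / d\<^sup>2 * (x * (1 - x) / real n)"
      using Bernstein_second_moment[OF n0] by simp
    also have "\<dots> \<le> e / 2 + 2 * M / d\<^sup>2 * (1 / real n)"
      using x M n0 by (intro add_left_mono mult_left_mono divide_right_mono) (auto intro: mult_le_one)
    also have "\<dots> < e"
    proof -
      have "4 * M / (d\<^sup>2 * e) < real n" using N n by simp
      then show ?thesis using d e n0 by (simp add: field_simps)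
    qed
    finally show "dist (\<Sum>k\<le>n. Bernstein n k x *\<^sub>R f (real k / real n)) (f x) < e"
      by (simp add: dist_norm)
  qed
qed

lemma continuous_on_Bernstein: "continuous_on S (\<lambda>s. Bernstein n k (s / r))"
  unfolding Bernstein_def by (cases "r = 0") (auto intro!: continuous_intros)

text \<open>Serves twice: for the semigroup law \<open>gconv_gconv\<close> and for
  \<open>bounded_semivariation_imp_regular\<close>. Bernstein polynomials of f are finite sums of
  monomials with vector coefficients, so scalar factors are absorbed into x.\<close>

lemma continuous_monomial_induct [consumes 2, case_names monomial add limit]:
  fixes f :: "real \<Rightarrow> 'a::real_normed_vector"
  assumes r: "0 < r" and f: "continuous_on {0..r} f"
    and monomial: "\<And>k x. P (\<lambda>s. s ^ k *\<^sub>R x)"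
    and add: "\<And>f g. continuous_on {0..r} f \<Longrightarrow> continuous_on {0..r} g \<Longrightarrow> P f \<Longrightarrow> P g
        \<Longrightarrow> P (\<lambda>s. f s + g s)"
    and limit: "\<And>F f. (\<And>n. continuous_on {0..r} (F n)) \<Longrightarrow> continuous_on {0..r} f
        \<Longrightarrow> (\<And>n. P (F n)) \<Longrightarrow> uniform_limit {0..r} F f sequentially \<Longrightarrow> P f"
  shows "P f"
proof -
  have zero: "P (\<lambda>s. 0)" using monomial[of 0 0] by simp
  have psum: "P (\<lambda>s. \<Sum>i\<in>I. g i s)"
    if "finite I" "\<And>i. i \<in> I \<Longrightarrow> continuous_on {0..r} (g i)" "\<And>i. i \<in> I \<Longrightarrow> P (g i)"
    for I :: "nat set" and g
    using that by (induction I rule: finite_induct) (auto intro!: zero add continuous_on_sum)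
  have poly: "P (\<lambda>s. p s *\<^sub>R x)" if p: "real_polynomial_function p" for p x
  proof -
    obtain a n where p: "p = (\<lambda>s. \<Sum>i\<le>n. a i * s ^ i)"
      using real_polynomial_function_imp_sum[OF p] by blast
    have "P (\<lambda>s. \<Sum>i\<le>n. s ^ i *\<^sub>R (a i *\<^sub>R x))"
      by (intro psum monomial continuous_intros finite_atMost)
    moreover have "(\<lambda>s. \<Sum>i\<le>n. s ^ i *\<^sub>R (a i *\<^sub>R x)) = (\<lambda>s. p s *\<^sub>R x)"
      by (simp add: p scaleR_sum_left mult.commute)
    ultimately show ?thesis by simp
  qed
  define F where "F n s = (\<Sum>k\<le>n. Bernstein n k (s / r) *\<^sub>R f (r * (real k / real n)))" for n s
  have PF: "P (F n)" for n
    unfolding F_def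
  proof (rule psum)
    fix k
    have "real_polynomial_function (\<lambda>s. Bernstein n k (s / r))"
      unfolding Bernstein_def by (intro real_polynomial_function.intros(2-4) real_polynomial_function_power
        real_polynomial_function_divide real_polynomial_function_diff real_polynomial_function.intros(1) bounded_linear_ident)
    then show "P (\<lambda>s. Bernstein n k (s / r) *\<^sub>R f (r * (real k / real n)))" by (rule poly)
  qed (auto intro!: continuous_intros continuous_on_Bernstein)
  have cF: "continuous_on {0..r} (F n)" for n
    unfolding F_def by (intro continuous_intros continuous_on_Bernstein)
  have "continuous_on {0..1} (\<lambda>x. f (r * x))"
    using r by (intro continuous_on_compose2[OF f]) (auto intro!: continuous_intros)
  from Bernstein_uniform_limit[OF this] have "uniform_limit {0..r} F f sequentially"
    unfolding uniform_limit_iff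
  proof (intro allI impI)
    fix e :: real
    assume *: "\<forall>e>0. \<forall>\<^sub>F n in sequentially. \<forall>x\<in>{0..1}.
        dist (\<Sum>k\<le>n. Bernstein n k x *\<^sub>R f (r * (real k / real n))) (f (r * x)) < e" and "0 < e"
    then have "\<forall>\<^sub>F n in sequentially. \<forall>x\<in>{0..1}.
        dist (\<Sum>k\<le>n. Bernstein n k x *\<^sub>R f (r * (real k / real n))) (f (r * x)) < e" by blast
    then show "\<forall>\<^sub>F n in sequentially. \<forall>s\<in>{0..r}. dist (F n s) (f s) < e"
    proof eventually_elim
      case (elim n)
      show ?case
      proof
        fix s assume "s \<in> {0..r}"
        then have "s / r \<in> {0..1}" "r * (s / r) = s" using r by auto
        then show "dist (F n s) (f s) < e" using elim unfolding F_def by metis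
      qed
    qed
  qed
  then show ?thesis using limit[of F f] cF f PF by blast
qed

section \<open>Convolution with the kernels g_\<beta>\<close>

lemma Gamma_plus1_pos: "0 < \<beta> \<Longrightarrow> Gamma (\<beta> + 1) = \<beta> * Gamma (\<beta>::real)"
  by (rule Gamma_plus1) (auto elim!: nonpos_Ints_cases)

lemma continuous_on_powr_const:
  fixes f :: "'b::topological_space \<Rightarrow> real"
  shows "0 < c \<Longrightarrow> continuous_on S f \<Longrightarrow> (\<And>x. x \<in> S \<Longrightarrow> 0 \<le> f x) \<Longrightarrow> continuous_on S (\<lambda>x. f x powr c)"
  by (rule continuous_on_powr') (auto intro: continuous_intros)

lemma unit_contraction:
  assumes "0 \<le> (t::real)" "0 \<le> w" "w \<le> 1" "0 < \<beta>"
  shows "0 \<le> t * (1 - w powr (1/\<beta>))" "t * (1 - w powr (1/\<beta>)) \<le> t"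
proof -
  have "w powr (1/\<beta>) \<le> 1 powr (1/\<beta>)"
    using assms by (intro powr_mono2) auto
  then have *: "0 \<le> w powr (1/\<beta>)" "w powr (1/\<beta>) \<le> 1" by auto
  show "0 \<le> t * (1 - w powr (1/\<beta>))" using * assms by simp
  show "t * (1 - w powr (1/\<beta>)) \<le> t" using * assms by (simp add: mult_left_le)
qed

text \<open>The mean of f on [0,t] for the probability density \<beta> (t - s)^(\<beta> - 1) /
  t^\<beta>, that is, g_\<beta> * f divided by t^\<beta> / Gamma(\<beta> + 1). Unlike that quotient
  it makes sense at t = 0, where its value is f 0.\<close>

definition gavg :: "real \<Rightarrow> (real \<Rightarrow> 'a::real_normed_vector) \<Rightarrow> real \<Rightarrow> 'a" where
  "gavg \<beta> f t = integral {0..1} (\<lambda>w. f (t * (1 - w powr (1/\<beta>))))"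

lemma gavg_integrand_continuous:
  fixes f :: "real \<Rightarrow> 'a::real_normed_vector"
  assumes "0 < \<beta>" "continuous_on {0..r} f"
  shows "continuous_on ({0..r} \<times> {0..1}) (\<lambda>(t, w). f (t * (1 - w powr (1/\<beta>))))"
proof -
  have "continuous_on ({0..r} \<times> {0..1}) (\<lambda>z. f (fst z * (1 - snd z powr (1/\<beta>))))"
  proof (rule continuous_on_compose2[OF assms(2)])
    show "continuous_on ({0..r} \<times> {0..1}) (\<lambda>z. fst z * (1 - snd z powr (1/\<beta>)))"
      using assms(1)
      by (intro continuous_on_mult continuous_on_diff continuous_on_powr_const continuous_on_fst
          continuous_on_snd continuous_on_id continuous_on_const) auto
    show "(\<lambda>z. fst z * (1 - snd z powr (1/\<beta>))) ` ({0..r} \<times> {0..1}) \<subseteq> {0..r}"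
    proof clarify
      fix t w :: real assume "t \<in> {0..r}" "w \<in> {0..1}"
      then show "fst (t, w) * (1 - snd (t, w) powr (1/\<beta>)) \<in> {0..r}"
        using unit_contraction[of t w \<beta>] assms(1) by auto
    qed
  qed
  then show ?thesis by (simp add: case_prod_beta)
qed

lemma gavg_integrand_continuous_at:
  fixes f :: "real \<Rightarrow> 'a::real_normed_vector"
  assumes "0 < \<beta>" "0 \<le> t" "continuous_on {0..t} f"
  shows "continuous_on {0..1} (\<lambda>w. f (t * (1 - w powr (1/\<beta>))))"
proof -
  have "continuous_on {0..1} (\<lambda>w. case (t, w) of (t, w) \<Rightarrow> f (t * (1 - w powr (1/\<beta>))))"
  proof (rule continuous_on_compose2[OF gavg_integrand_continuous[OF assms(1,3)]])
    show "continuous_on {0..1} (Pair t)" by (intro continuous_intros)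
  qed (use assms(2) in auto)
  then show ?thesis by simp
qed

lemma gavg_continuous:
  fixes f :: "real \<Rightarrow> 'a::banach"
  assumes "0 < \<beta>" "continuous_on {0..r} f"
  shows "continuous_on {0..r} (gavg \<beta> f)"
  using integral_continuous_on_param[of "{0..r}" "0::real" 1 "\<lambda>t w. f (t * (1 - w powr (1/\<beta>)))"]
    gavg_integrand_continuous[OF assms] by (simp add: gavg_def)

lemma norm_gavg_le:
  fixes f :: "real \<Rightarrow> 'a::banach"
  assumes "0 < \<beta>" "0 \<le> t" "continuous_on {0..t} f" "\<And>s. s \<in> {0..t} \<Longrightarrow> norm (f s) \<le> B"
  shows "norm (gavg \<beta> f t) \<le> B"
proof -
  have "norm (gavg \<beta> f t) \<le> B * (1 - 0)" unfolding gavg_def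
  proof (rule integral_bound[OF _ gavg_integrand_continuous_at[OF assms(1-3)]])
    fix w :: real assume "w \<in> {0..1}"
    then show "norm (f (t * (1 - w powr (1/\<beta>)))) \<le> B"
      using unit_contraction[of t w \<beta>] assms by auto
  qed simp
  then show ?thesis by simp
qed

text \<open>The substitution w = ((t - s) / t) powr \<beta> removes the singularity of the kernel, so that
  only integrals of continuous functions remain.\<close>

lemma gconv_has_integral:
  fixes f :: "real \<Rightarrow> 'a::banach"
  assumes b: "0 < \<beta>" and t: "0 \<le> t" and f: "continuous_on {0..t} f"
  shows "((\<lambda>s. gk \<beta> (t - s) *\<^sub>R f s) has_integral (t powr \<beta> / Gamma (\<beta> + 1)) *\<^sub>R gavg \<beta> f t) {0..t}"
proof (cases "t = 0")
  case True
  then show ?thesis using has_integral_refl(2)[of _ "0::real"] by simp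
next
  case False
  with t have t0: "0 < t" by simp
  define \<phi> where "\<phi> w = f (t * (1 - w powr (1/\<beta>)))" for w
  define \<Phi> where "\<Phi> z = integral {0..z} \<phi>" for z
  \<comment> \<open>Antiderivative of the integrand in s; the minus sign is there because w falls
    from 1 to 0 as s runs through [0,t].\<close>
  define G where "G s = - ((t powr \<beta> / Gamma (\<beta> + 1)) *\<^sub>R \<Phi> (((t - s) / t) powr \<beta>))" for s
  have \<phi>: "continuous_on {0..1} \<phi>"
    using gavg_integrand_continuous_at[OF b t f] by (simp add: \<phi>_def[abs_def])
  have d\<Phi>: "(\<Phi> has_vector_derivative \<phi> z) (at z within {0..1})" if "z \<in> {0..1}" for z
    unfolding \<Phi>_def using integral_has_vector_derivative[OF \<phi> that] .
  have c\<Phi>: "continuous_on {0..1} \<Phi>"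
    by (rule continuous_on_vector_derivative[OF d\<Phi>])
  have "((\<lambda>s. gk \<beta> (t - s) *\<^sub>R f s) has_integral (G t - G 0)) {0..t}"
  \<comment> \<open>Derivatives are taken in the open interval only: for \<beta> < 1 the kernel
    blows up at s = t, while \<open>G\<close> stays continuous there.\<close>
  proof (rule fundamental_theorem_of_calculus_interior[OF t])
    have "continuous_on {0..t} (\<lambda>s. \<Phi> (((t - s) / t) powr \<beta>))"
    proof (rule continuous_on_compose2[OF c\<Phi>])
      show "continuous_on {0..t} (\<lambda>s. ((t - s) / t) powr \<beta>)"
        using b t0 by (intro continuous_on_powr_const continuous_intros) auto
      show "(\<lambda>s. ((t - s) / t) powr \<beta>) ` {0..t} \<subseteq> {0..1}"
        using b t0 by (auto intro!: powr_le1)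
    qed
    then show "continuous_on {0..t} G"
      unfolding G_def by (intro continuous_intros)
    fix s assume s: "s \<in> {0<..<t}"
    define z where "z = ((t - s) / t) powr \<beta>"
    have q: "0 < (t - s) / t" "(t - s) / t < 1" using s t0 by auto
    have "z < 1 powr \<beta>" unfolding z_def using q b by (intro powr_less_mono2) auto
    then have z: "0 < z" "z < 1" using q by (auto simp: z_def)
    have dz: "((\<lambda>s. ((t - s) / t) powr \<beta>) has_field_derivative
        (- (\<beta> * ((t - s) / t) powr (\<beta> - 1) / t))) (at s)"
      using q t0 s by (auto intro!: derivative_eq_intros simp: field_simps powr_diff)
    have "(\<Phi> has_vector_derivative \<phi> z) (at z within {0<..<1})"
      using d\<Phi>[of z] z by (auto intro: has_vector_derivative_within_subset)
    then have "(\<Phi> has_vector_derivative \<phi> z) (at z)"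
      using z by (metis at_within_open greaterThanLessThan_iff open_greaterThanLessThan)
    then have "((\<Phi> \<circ> (\<lambda>s. ((t - s) / t) powr \<beta>)) has_vector_derivative
        (- (\<beta> * ((t - s) / t) powr (\<beta> - 1) / t)) *\<^sub>R \<phi> z) (at s)"
      unfolding z_def by (rule vector_diff_chain_at[OF dz[unfolded has_real_derivative_iff_has_vector_derivative]])
    then have "(G has_vector_derivative - ((t powr \<beta> / Gamma (\<beta> + 1)) *\<^sub>R
        (- (\<beta> * ((t - s) / t) powr (\<beta> - 1) / t)) *\<^sub>R \<phi> z)) (at s)"
      unfolding G_def o_def
      by (intro has_vector_derivative_minus bounded_linear.has_vector_derivative[OF bounded_linear_scaleR_right])
    moreover have "z powr (1/\<beta>) = (t - s) / t"
      using q b s t0 by (simp add: z_def powr_powr)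
    then have "t * (1 - z powr (1/\<beta>)) = s" using t0 by (simp add: field_simps)
    then have "\<phi> z = f s" by (simp add: \<phi>_def)
    moreover have "t powr \<beta> / Gamma (\<beta> + 1) * (\<beta> * ((t - s) / t) powr (\<beta> - 1) / t) = gk \<beta> (t - s)"
    proof -
      have "t powr \<beta> * ((t - s) / t) powr (\<beta> - 1) / t = (t - s) powr (\<beta> - 1)"
        using s t0 by (simp add: powr_divide powr_diff field_simps)
      moreover have "\<beta> / Gamma (\<beta> + 1) = 1 / Gamma \<beta>"
        using b by (simp add: Gamma_plus1_pos)
      ultimately have "t powr \<beta> * ((t - s) / t) powr (\<beta> - 1) / t * (\<beta> / Gamma (\<beta> + 1)) = gk \<beta> (t - s)"
        using s by (simp add: gk_def)
      then show ?thesis by (simp add: ac_simps)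
    qed
    ultimately show "(G has_vector_derivative gk \<beta> (t - s) *\<^sub>R f s) (at s)"
      by simp
  qed
  moreover have "G t - G 0 = (t powr \<beta> / Gamma (\<beta> + 1)) *\<^sub>R gavg \<beta> f t"
    using t0 b by (simp add: G_def \<Phi>_def gavg_def \<phi>_def[abs_def])
  ultimately show ?thesis by simp
qed

lemma gconv_integrable:
  fixes f :: "real \<Rightarrow> 'a::banach"
  assumes "0 < \<beta>" "0 \<le> t" "continuous_on {0..t} f"
  shows "(\<lambda>s. gk \<beta> (t - s) *\<^sub>R f s) integrable_on {0..t}"
  using gconv_has_integral[OF assms] by blast

lemma gconv_eq_gavg:
  fixes f :: "real \<Rightarrow> 'a::banach"
  assumes "0 < \<beta>" "0 \<le> t" "continuous_on {0..t} f"
  shows "gconv \<beta> f t = (t powr \<beta> / Gamma (\<beta> + 1)) *\<^sub>R gavg \<beta> f t"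
  unfolding gconv_def using gconv_has_integral[OF assms] by blast

lemma gconv_continuous:
  fixes f :: "real \<Rightarrow> 'a::banach"
  assumes "0 < \<beta>" "continuous_on {0..r} f"
  shows "continuous_on {0..r} (gconv \<beta> f)"
proof -
  have "continuous_on {0..r} (\<lambda>t. (t powr \<beta> / Gamma (\<beta> + 1)) *\<^sub>R gavg \<beta> f t)"
    using assms by (intro continuous_intros gavg_continuous continuous_on_powr_const)
      (auto simp: Gamma_eq_zero_iff elim!: nonpos_Ints_cases)
  then show ?thesis
    by (rule continuous_on_eq)
       (use assms in \<open>auto intro!: gconv_eq_gavg[symmetric] continuous_on_subset[OF assms(2)]\<close>)
qed

lemma norm_gconv_le:
  fixes f :: "real \<Rightarrow> 'a::banach"
  assumes "0 < \<beta>" "0 \<le> t" "continuous_on {0..t} f" "\<And>s. s \<in> {0..t} \<Longrightarrow> norm (f s) \<le> B"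
  shows "norm (gconv \<beta> f t) \<le> t powr \<beta> / Gamma (\<beta> + 1) * B"
proof -
  have "0 < Gamma (\<beta> + 1)" using assms by simp
  then show ?thesis
    using norm_gavg_le[OF assms] by (simp add: gconv_eq_gavg[OF assms(1-3)] divide_right_mono mult_left_mono)
qed

lemma gconv_cong:
  "(\<And>s. s \<in> {0..t} \<Longrightarrow> f s = g s) \<Longrightarrow> gconv \<beta> f t = gconv \<beta> g t"
  unfolding gconv_def by (rule integral_cong) simp

lemma gconv_cong_pos:
  assumes "\<And>s. s \<in> {0<..t} \<Longrightarrow> f s = g s"
  shows "gconv \<beta> f t = gconv \<beta> g t"
  unfolding gconv_def by (rule integral_spike[of "{0}"]) (use assms in auto)

lemma gconv_add:
  fixes f g :: "real \<Rightarrow> 'a::banach"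
  assumes "0 < \<beta>" "0 \<le> t" "continuous_on {0..t} f" "continuous_on {0..t} g"
  shows "gconv \<beta> (\<lambda>s. f s + g s) t = gconv \<beta> f t + gconv \<beta> g t"
  unfolding gconv_def scaleR_add_right using assms by (intro integral_add gconv_integrable)

lemma gconv_diff:
  fixes f g :: "real \<Rightarrow> 'a::banach"
  assumes "0 < \<beta>" "0 \<le> t" "continuous_on {0..t} f" "continuous_on {0..t} g"
  shows "gconv \<beta> (\<lambda>s. f s - g s) t = gconv \<beta> f t - gconv \<beta> g t"
  unfolding gconv_def scaleR_diff_right using assms by (intro integral_diff gconv_integrable)

lemma gconv_scaleR: "gconv \<beta> (\<lambda>s. c *\<^sub>R f s) t = c *\<^sub>R gconv \<beta> f t"
  unfolding gconv_def scaleR_left_commute[of _ c] by (rule integral_cmul)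

lemma gconv_0 [simp]: "gconv \<beta> f 0 = 0"
  by (simp add: gconv_def)

lemma gconv_1: "gconv 1 f t = integral {0..t} f"
  unfolding gconv_def by (rule integral_spike[of "{t}"]) (auto simp: gk_def)

lemma gconv_uniform_limit:
  fixes f :: "real \<Rightarrow> 'a::banach"
  assumes b: "0 < \<beta>" and f: "\<And>n. continuous_on {0..r} (F n)" "continuous_on {0..r} f"
    and lim: "uniform_limit {0..r} F f sequentially"
  shows "uniform_limit {0..r} (\<lambda>n. gconv \<beta> (F n)) (gconv \<beta> f) sequentially"
proof (rule uniform_limitI)
  fix e :: real assume e: "0 < e"
  define K where "K = r powr \<beta> / Gamma (\<beta> + 1)"
  have G: "0 < Gamma (\<beta> + 1)" using b by simp
  then have K: "0 \<le> K" by (simp add: K_def)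
  have "\<forall>\<^sub>F n in sequentially. \<forall>s\<in>{0..r}. dist (F n s) (f s) < e / (K + 1)"
    using lim K e by (auto simp: uniform_limit_iff)
  then show "\<forall>\<^sub>F n in sequentially. \<forall>t\<in>{0..r}. dist (gconv \<beta> (F n) t) (gconv \<beta> f t) < e"
  proof eventually_elim
    case (elim n)
    show ?case
    proof
      fix t assume t: "t \<in> {0..r}"
      have sub: "{0..t} \<subseteq> {0..r}" using t by auto
      have cf: "continuous_on {0..t} (F n)" "continuous_on {0..t} f"
        using f continuous_on_subset[OF _ sub] by blast+
      have "norm (gconv \<beta> (\<lambda>s. F n s - f s) t) \<le> t powr \<beta> / Gamma (\<beta> + 1) * (e / (K + 1))"
      proof (rule norm_gconv_le[OF b])
        show "continuous_on {0..t} (\<lambda>s. F n s - f s)" using cf by (intro continuous_intros)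
      qed (use elim t sub in \<open>auto simp: dist_norm intro: less_imp_le\<close>)
      also have "\<dots> \<le> K * (e / (K + 1))"
        unfolding K_def using t b G e by (intro mult_right_mono divide_right_mono powr_mono2) auto
      also have "\<dots> < e" using K e by (simp add: field_simps)
      finally show "dist (gconv \<beta> (F n) t) (gconv \<beta> f t) < e"
        using gconv_diff[OF b _ cf] t by (simp add: dist_norm)
    qed
  qed
qed

text \<open>Euler's Beta integral B(b,a) = Gamma a Gamma b / Gamma(a + b), rescaled from [0,1] to
  [0,t]. It needs its own proof because g_b may be singular at 0.\<close>

lemma gconv_gk:
  assumes a: "0 < a" and b: "0 < b"
  shows "gconv a (\<lambda>s. gk b s *\<^sub>R (x::'a::banach)) t = gk (a + b) t *\<^sub>R x"
proof (cases "0 < t")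
  case False
  have "integral {0..t} (\<lambda>s. gk a (t - s) *\<^sub>R gk b s *\<^sub>R x) = 0"
    using False by (cases "t = 0") auto
  then show ?thesis using False by (simp add: gconv_def gk_def[of "a + b"])
next
  case True
  have "((\<lambda>u. u powr (b - 1) * (1 - u) powr (a - 1)) has_integral Beta b a) (cbox 0 1)"
    using has_integral_Beta_real[OF b a] by simp
  from has_integral_affinity'[OF this, of "1/t" 0]
  have "((\<lambda>s. (s / t) powr (b - 1) * (1 - s / t) powr (a - 1)) has_integral t * Beta b a) {0..t}"
    using True by simp
  from has_integral_mult_right[OF this, of "t powr (b - 1) * t powr (a - 1) / (Gamma a * Gamma b)"]
  have "((\<lambda>s. t powr (b - 1) * t powr (a - 1) / (Gamma a * Gamma b) * ((s / t) powr (b - 1) * (1 - s / t) powr (a - 1)))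
     has_integral t powr (b - 1) * t powr (a - 1) / (Gamma a * Gamma b) * (t * Beta b a)) {0..t}" .
  then have "((\<lambda>s. gk a (t - s) * gk b s) has_integral
     t powr (b - 1) * t powr (a - 1) / (Gamma a * Gamma b) * (t * Beta b a)) {0..t}"
  proof (rule has_integral_spike_finite[of "{0,t}", rotated 2])
    fix s assume "s \<in> {0..t} - {0,t}"
    then have s: "0 < s" "s < t" by auto
    have "t powr (b - 1) * (s / t) powr (b - 1) = s powr (b - 1)"
      using s by (simp add: powr_mult[symmetric])
    moreover have "t powr (a - 1) * (1 - s / t) powr (a - 1) = (t - s) powr (a - 1)"
    proof -
      have "t * (1 - s / t) = t - s" using s by (simp add: field_simps)
      then show ?thesis using s by (simp add: powr_mult[symmetric])
    qed
    ultimately have "gk a (t - s) * gk b s = (t powr (a - 1) * (1 - s / t) powr (a - 1)) *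
        (t powr (b - 1) * (s / t) powr (b - 1)) / (Gamma a * Gamma b)"
      using s by (simp add: gk_def)
    then show "gk a (t - s) * gk b s = t powr (b - 1) * t powr (a - 1) / (Gamma a * Gamma b) *
        ((s / t) powr (b - 1) * (1 - s / t) powr (a - 1))"
      by (simp add: ac_simps)
  qed simp
  moreover have "t powr (b - 1) * t powr (a - 1) / (Gamma a * Gamma b) * (t * Beta b a) = gk (a + b) t"
  proof -
    have "t powr (b - 1) * t powr (a - 1) * t = t powr (a + b - 1)"
      using True by (simp add: powr_add powr_diff field_simps)
    moreover have "Gamma a > 0" "Gamma b > 0" using a b by auto
    ultimately show ?thesis using True by (simp add: gk_def Beta_def field_simps)
  qed
  ultimately have "((\<lambda>s. gk a (t - s) * gk b s) has_integral gk (a + b) t) {0..t}" by simp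
  from has_integral_scaleR_left[OF this, of x] show ?thesis
    by (simp add: gconv_def integral_unique)
qed

lemma power_eq_gk: "0 < s \<Longrightarrow> s ^ k = fact k * gk (real k + 1) s"
  using Gamma_fact[of k, where 'a=real] by (simp add: gk_def powr_realpow add.commute)

lemma gconv_power:
  assumes "0 < a"
  shows "gconv a (\<lambda>s. s ^ k *\<^sub>R (x::'a::banach)) t = (fact k * gk (a + real k + 1) t) *\<^sub>R x"
proof -
  have "gconv a (\<lambda>s. s ^ k *\<^sub>R x) t = gconv a (\<lambda>s. fact k *\<^sub>R gk (real k + 1) s *\<^sub>R x) t"
    \<comment> \<open>Positive s only: for k = 0 the power is 1 at s = 0, whereas \<open>gk\<close>
      vanishes there.\<close>
    by (rule gconv_cong_pos) (simp add: power_eq_gk)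
  also have "\<dots> = fact k *\<^sub>R gk (a + (real k + 1)) t *\<^sub>R x"
    using assms by (subst gconv_scaleR) (simp add: gconv_gk)
  finally show ?thesis by (simp add: add.assoc)
qed

text \<open>Monomials are multiples of g_(k+1), so \<open>gconv_gk\<close> settles them; both sides
  are additive and continuous under uniform convergence.\<close>

lemma gconv_gconv:
  fixes f :: "real \<Rightarrow> 'a::banach"
  assumes a: "0 < a" and b: "0 < b" and f: "continuous_on {0..t} f" and t: "0 \<le> t"
  shows "gconv a (gconv b f) t = gconv (a + b) f t"
proof (cases "t = 0")
  case False
  with t have "0 < t" by simp
  from this f show ?thesis
  proof (induction rule: continuous_monomial_induct)
    case (monomial k x)
    have "gconv b (\<lambda>s. s ^ k *\<^sub>R x) = (\<lambda>s. fact k *\<^sub>R gk (b + real k + 1) s *\<^sub>R x)"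
      using gconv_power[OF b] by (intro ext) simp
    then show ?case
      using a b by (simp only: gconv_scaleR gconv_gk gconv_power) (simp add: gconv_gk add.assoc)
  next
    case (add f g)
    have "gconv a (gconv b (\<lambda>s. f s + g s)) t = gconv a (\<lambda>s. gconv b f s + gconv b g s) t"
      using add(1,2) b by (intro gconv_cong gconv_add) (auto intro: continuous_on_subset)
    also have "\<dots> = gconv a (gconv b f) t + gconv a (gconv b g) t"
      using add(1,2) a b t by (intro gconv_add gconv_continuous)
    also have "\<dots> = gconv (a + b) (\<lambda>s. f s + g s) t"
      using add a b t by (simp add: gconv_add)
    finally show ?case .
  next
    case (limit F f)
    have "uniform_limit {0..t} (\<lambda>n. gconv b (F n)) (gconv b f) sequentially"
      using limit b by (intro gconv_uniform_limit)
    then have "uniform_limit {0..t} (\<lambda>n. gconv a (gconv b (F n))) (gconv a (gconv b f)) sequentially"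
      by (rule gconv_uniform_limit[OF a gconv_continuous[OF b limit(1)] gconv_continuous[OF b limit(2)]])
    then have "(\<lambda>n. gconv a (gconv b (F n)) t) \<longlonglongrightarrow> gconv a (gconv b f) t"
      by (rule tendsto_uniform_limitI) (use t in simp)
    moreover have "uniform_limit {0..t} (\<lambda>n. gconv (a + b) (F n)) (gconv (a + b) f) sequentially"
      using limit a b by (intro gconv_uniform_limit) auto
    then have "(\<lambda>n. gconv (a + b) (F n) t) \<longlonglongrightarrow> gconv (a + b) f t"
      by (rule tendsto_uniform_limitI) (use t in simp)
    ultimately show ?case
      using limit.IH LIMSEQ_unique by simp
  qed
qed simp

section \<open>Integrals and closed operators\<close>

text \<open>The common Lipschitz constant controls T s (f s) - T s (f a), which leaves strong
  continuity at the fixed vector f a.\<close>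

lemma continuous_on_family_apply:
  fixes T :: "'t::topological_space \<Rightarrow> 'b::real_normed_vector \<Rightarrow> 'c::real_normed_vector"
  assumes f: "continuous_on U f" and T: "\<And>x. continuous_on U (\<lambda>s. T s x)"
    and K: "\<And>s x y. s \<in> U \<Longrightarrow> norm (T s x - T s y) \<le> K * norm (x - y)"
  shows "continuous_on U (\<lambda>s. T s (f s))"
  unfolding continuous_on_def
proof
  fix a assume a: "a \<in> U"
  have "((\<lambda>s. T s (f s) - T s (f a)) \<longlongrightarrow> 0) (at a within U)"
  proof (rule Lim_null_comparison)
    show "\<forall>\<^sub>F s in at a within U. norm (T s (f s) - T s (f a)) \<le> K * norm (f s - f a)"
      using K by (auto simp: eventually_at_topological)
    have "((\<lambda>s. K * norm (f s - f a)) \<longlongrightarrow> K * norm (f a - f a)) (at a within U)"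
      using f a by (intro tendsto_intros) (auto simp: continuous_on_def)
    then show "((\<lambda>s. K * norm (f s - f a)) \<longlongrightarrow> 0) (at a within U)" by simp
  qed
  moreover have "((\<lambda>s. T s (f a)) \<longlongrightarrow> T a (f a)) (at a within U)"
    using T a by (auto simp: continuous_on_def)
  ultimately have "((\<lambda>s. T s (f s) - T s (f a) + T s (f a)) \<longlongrightarrow> 0 + T a (f a)) (at a within U)"
    by (rule tendsto_add)
  then show "((\<lambda>s. T s (f s)) \<longlongrightarrow> T a (f a)) (at a within U)" by simp
qed

lemma integral_reflect_interval:
  fixes h :: "real \<Rightarrow> 'a::banach"
  assumes "continuous_on {0..t} h"
  shows "integral {0..t} (\<lambda>s. h (t - s)) = integral {0..t} h"
proof -
  have "(h has_integral integral {0..t} h) (cbox 0 t)"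
    using integrable_continuous_real[OF assms] by (simp add: integrable_integral)
  from has_integral_affinity[OF this, of "-1" t]
  have "((\<lambda>s. h (t - s)) has_integral integral {0..t} h) ((\<lambda>x. t - x) ` {0..t})"
    by simp
  moreover have "(\<lambda>x. t - x) ` {0..t} = {0..t}" by simp
  ultimately show ?thesis by (metis integral_unique)
qed

lemma integral_partition:
  fixes h :: "real \<Rightarrow> 'a::banach"
  assumes h: "continuous_on {d 0..d m} h" and d: "\<And>i. i < m \<Longrightarrow> d i \<le> d (Suc i)"
  shows "integral {d 0..d m} h = (\<Sum>i\<in>{1..m}. integral {d (i - 1)..d i} h)"
  using assms
proof (induction m)
  case (Suc m)
  have le: "d 0 \<le> d k" if "k \<le> m" for k
    using that
  proof (induction k)
    case (Suc k)
    then have "d k \<le> d (Suc k)" using Suc.prems(1) \<open>\<And>i. i < Suc m \<Longrightarrow> d i \<le> d (Suc i)\<close> by simp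
    then show ?case using Suc by simp
  qed simp
  have "d m \<le> d (Suc m)" using Suc.prems by simp
  then have "integral {d 0..d m} h + integral {d m..d (Suc m)} h = integral {d 0..d (Suc m)} h"
    using le[of m] integrable_continuous_real[OF Suc.prems(1)] by (simp add: Henstock_Kurzweil_Integration.integral_combine)
  moreover have "integral {d 0..d m} h = (\<Sum>i\<in>{1..m}. integral {d (i - 1)..d i} h)"
  proof (rule Suc.IH)
    show "continuous_on {d 0..d m} h"
      by (rule continuous_on_subset[OF Suc.prems(1)]) (use \<open>d m \<le> d (Suc m)\<close> in auto)
  qed (use Suc.prems in simp)
  ultimately show ?case by simp
qed simp

text \<open>The gauge integral is approximated by Riemann sums with tags in [a,b]; each of them lies
  in V, so no ball around I can miss V.\<close>

lemma integral_in_closed_subspace: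
  fixes f :: "real \<Rightarrow> 'a::real_normed_vector"
  assumes V: "subspace V" "closed V" and f: "(f has_integral I) {a..b}" "\<And>s. s \<in> {a..b} \<Longrightarrow> f s \<in> V"
  shows "I \<in> V"
proof (rule ccontr)
  assume "I \<notin> V"
  then obtain e where e: "0 < e" "ball I e \<subseteq> - V"
    using V(2) by (metis ComplI open_Compl open_contains_ball)
  have "(f has_integral I) (cbox a b)" using f by simp
  from this[unfolded has_integral, rule_format, OF e(1)] obtain \<gamma> where
    g: "gauge \<gamma>" "\<forall>p. p tagged_division_of cbox a b \<and> \<gamma> fine p \<longrightarrow>
      norm ((\<Sum>(x,k)\<in>p. Henstock_Kurzweil_Integration.content k *\<^sub>R f x) - I) < e"
    by (elim exE conjE)
  obtain p where p: "p tagged_division_of cbox a b" "\<gamma> fine p"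
    using fine_division_exists[OF g(1)] by blast
  have "(\<Sum>(x,k)\<in>p. Henstock_Kurzweil_Integration.content k *\<^sub>R f x) \<in> V"
  proof (rule subspace_sum[OF V(1)])
    fix z assume z: "z \<in> p"
    obtain x k where xk: "z = (x, k)" by (cases z)
    then have "x \<in> {a..b}" using tag_in_interval[OF p(1), of x k] z by simp
    then show "(case z of (x, k) \<Rightarrow> Henstock_Kurzweil_Integration.content k *\<^sub>R f x) \<in> V"
      using f(2) xk V(1) by (simp add: subspace_scale)
  qed
  moreover have "(\<Sum>(x,k)\<in>p. Henstock_Kurzweil_Integration.content k *\<^sub>R f x) \<in> ball I e"
    using g(2)[rule_format, OF conjI[OF p]] by (simp add: dist_norm norm_minus_commute)
  ultimately show False using e(2) by blast
qed

text \<open>Hille's theorem: the pair (f, A f) takes values in the graph of A, a closed subspace of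
  the product, so its integral (I, J) lies there too.\<close>

lemma closed_op_integral:
  fixes f :: "real \<Rightarrow> 'a::banach"
  assumes A: "closed_dense_op D A" and D: "\<And>s. s \<in> {a..b} \<Longrightarrow> f s \<in> D"
    and f: "(f has_integral I) {a..b}" "((\<lambda>s. A (f s)) has_integral J) {a..b}"
  shows "I \<in> D" "A I = J"
proof -
  define G where "G = {(x, A x) |x. x \<in> D}"
  note op = A[unfolded closed_dense_op_def]
  have cl: "closed G" using op by (simp add: G_def)
  have D0: "subspace D" using op by simp
  have A0: "A 0 = 0" using op subspace_0[OF D0] by (metis scale_zero_left)
  have sub: "subspace G"
    unfolding subspace_def
  proof (intro conjI ballI allI)
    show "0 \<in> G" using A0 subspace_0[OF D0] by (auto simp: G_def zero_prod_def)
    fix z w c assume "z \<in> G"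
    then obtain x where x: "x \<in> D" "z = (x, A x)" by (auto simp: G_def)
    show "z + w \<in> G" if "w \<in> G"
    proof -
      from that obtain y where y: "y \<in> D" "w = (y, A y)" by (auto simp: G_def)
      have "A (x + y) = A x + A y" using op x y by blast
      then show ?thesis using x y subspace_add[OF D0] by (auto simp: G_def)
    qed
    have "A (c *\<^sub>R x) = c *\<^sub>R A x" using op x by blast
    then show "c *\<^sub>R z \<in> G" using x subspace_scale[OF D0] by (auto simp: G_def)
  qed
  have "((\<lambda>s. (f s, 0) + (0, A (f s))) has_integral ((I, 0) + (0, J))) {a..b}"
  proof (rule has_integral_add)
    have "bounded_linear (\<lambda>x::'a. (x, 0::'a))" "bounded_linear (\<lambda>x::'a. (0::'a, x))"
      by (auto intro!: bounded_linear_Pair bounded_linear_ident bounded_linear_zero)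
    from has_integral_linear[OF f(1) this(1)] has_integral_linear[OF f(2) this(2)]
    show "((\<lambda>s. (f s, 0::'a)) has_integral (I, 0)) {a..b}"
      "((\<lambda>s. (0::'a, A (f s))) has_integral (0, J)) {a..b}" by (simp_all add: o_def)
  qed
  then have "((\<lambda>s. (f s, A (f s))) has_integral (I, J)) {a..b}" by simp
  from integral_in_closed_subspace[OF sub cl this] have "(I, J) \<in> G"
    using D by (auto simp: G_def)
  then show "I \<in> D" "A I = J" by (auto simp: G_def)
qed

lemma closed_op_gconv:
  fixes f :: "real \<Rightarrow> 'a::banach"
  assumes A: "closed_dense_op D A" and b: "0 < \<beta>" "0 \<le> t"
    and D: "\<And>s. s \<in> {0..t} \<Longrightarrow> f s \<in> D"
    and f: "continuous_on {0..t} f" "continuous_on {0..t} (\<lambda>s. A (f s))"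
  shows "gconv \<beta> f t \<in> D" "A (gconv \<beta> f t) = gconv \<beta> (\<lambda>s. A (f s)) t"
proof -
  note op = A[unfolded closed_dense_op_def]
  have 1: "((\<lambda>s. gk \<beta> (t - s) *\<^sub>R f s) has_integral gconv \<beta> f t) {0..t}"
    unfolding gconv_def using gconv_integrable[OF b f(1)] by (rule integrable_integral)
  have "((\<lambda>s. gk \<beta> (t - s) *\<^sub>R A (f s)) has_integral gconv \<beta> (\<lambda>s. A (f s)) t) {0..t}"
    unfolding gconv_def using gconv_integrable[OF b f(2)] by (rule integrable_integral)
  then have 2: "((\<lambda>s. A (gk \<beta> (t - s) *\<^sub>R f s)) has_integral gconv \<beta> (\<lambda>s. A (f s)) t) {0..t}"
    by (rule has_integral_eq[rotated]) (use op D in auto)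
  have "gk \<beta> (t - s) *\<^sub>R f s \<in> D" if "s \<in> {0..t}" for s
    using op D[OF that] by (auto intro: subspace_scale)
  from closed_op_integral[OF A this 1 2] show "gconv \<beta> f t \<in> D"
    "A (gconv \<beta> f t) = gconv \<beta> (\<lambda>s. A (f s)) t" by auto
qed

lemma closed_op_limit:
  assumes A: "closed_dense_op D A" and x: "\<And>n. x n \<in> D" "x \<longlonglongrightarrow> l" "(\<lambda>n. A (x n)) \<longlonglongrightarrow> m"
  shows "l \<in> D" "A l = m"
proof -
  have "closed {(x, A x) |x. x \<in> D}" using A by (simp add: closed_dense_op_def)
  moreover have "(x n, A (x n)) \<in> {(x, A x) |x. x \<in> D}" for n using x(1) by blast
  moreover have "(\<lambda>n. (x n, A (x n))) \<longlonglongrightarrow> (l, m)" using x by (intro tendsto_Pair)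
  ultimately have "(l, m) \<in> {(x, A x) |x. x \<in> D}" by (rule closed_sequentially)
  then show "l \<in> D" "A l = m" by auto
qed

section \<open>Subdivisions and semivariation\<close>

lemma subdivision_mono:
  assumes "subdivision a b d n" "i \<le> j" "j \<le> n"
  shows "d i \<le> d j"
  using assms(2,3)
proof (induction j rule: dec_induct)
  case (step j)
  then have "d j < d (Suc j)" using assms(1) by (auto simp: subdivision_def)
  then show ?case using step by simp
qed simp

lemma subdivision_range:
  assumes "subdivision a b d n" "i \<le> n"
  shows "d i \<in> {a..b}"
  using subdivision_mono[OF assms(1), of 0 i] subdivision_mono[OF assms(1), of i n] assms
  by (auto simp: subdivision_def)

lemma bounded_semivariationD:
  fixes G :: "real \<Rightarrow> 'a::real_normed_vector \<Rightarrow>\<^sub>L 'a"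
  assumes "bounded_semivariation G a b"
  obtains V where "0 \<le> V"
    "\<And>d n xs B. subdivision a b d n \<Longrightarrow> 0 < B \<Longrightarrow> (\<And>i. norm (xs i) \<le> B) \<Longrightarrow>
      norm (\<Sum>i\<in>{1..n}. blinfun_apply (G (d i) - G (d (i - 1))) (xs i)) \<le> V * B"
proof -
  \<comment> \<open>For b < a there are no subdivisions and \<open>SV\<close> is the supremum of the
    empty set; the maximum with 0 gives a nonnegative real in every case.\<close>
  define V where "V = real_of_ereal (max 0 (SV G a b))"
  have V: "ereal V = max 0 (SV G a b)"
    using assms by (cases "SV G a b") (auto simp: V_def max_def bounded_semivariation_def)
  have "0 \<le> V" using V by (metis ereal_less_eq(5) max.cobounded1)
  moreover have "norm (\<Sum>i\<in>{1..n}. blinfun_apply (G (d i) - G (d (i - 1))) (xs i)) \<le> V * B"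
    if d: "subdivision a b d n" and B: "0 < B" and xs: "\<And>i. norm (xs i) \<le> B" for d n xs B
  proof -
    define ys where "ys i = (1 / B) *\<^sub>R xs i" for i
    have ys: "norm (ys i) \<le> 1" for i using xs[of i] B by (simp add: ys_def)
    have "ereal (norm (\<Sum>i\<in>{1..n}. blinfun_apply (G (d i) - G (d (i - 1))) (ys i))) \<le> SV_d G d n"
      unfolding SV_d_def by (rule SUP_upper) (use ys in simp)
    also have "\<dots> \<le> SV G a b"
      unfolding SV_def using SUP_upper[of "(d, n)" "{(d, n). subdivision a b d n}"
        "\<lambda>dn. SV_d G (fst dn) (snd dn)"] d by simp
    also have "\<dots> \<le> ereal V" unfolding V by simp
    finally have "norm (\<Sum>i\<in>{1..n}. blinfun_apply (G (d i) - G (d (i - 1))) (ys i)) \<le> V" by simp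
    moreover have "(\<Sum>i\<in>{1..n}. blinfun_apply (G (d i) - G (d (i - 1))) (xs i))
        = B *\<^sub>R (\<Sum>i\<in>{1..n}. blinfun_apply (G (d i) - G (d (i - 1))) (ys i))"
      using B by (simp add: scaleR_sum_right ys_def blinfun.scaleR_right)
    ultimately show ?thesis using B by (simp add: mult.commute)
  qed
  ultimately show thesis by (rule that)
qed

text \<open>One constant has to serve every right end point c, because A (P * f) is to be estimated
  uniformly in time. A subdivision of [a,c] with c < b is prolonged by the node b carrying the
  vector 0.\<close>

lemma bounded_semivariation_initial:
  fixes G :: "real \<Rightarrow> 'a::real_normed_vector \<Rightarrow>\<^sub>L 'a"
  assumes "bounded_semivariation G a b"
  obtains V where "0 \<le> V"
    "\<And>c d n xs B. c \<le> b \<Longrightarrow> subdivision a c d n \<Longrightarrow> 0 < B \<Longrightarrow> (\<And>i. norm (xs i) \<le> B) \<Longrightarrow>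
      norm (\<Sum>i\<in>{1..n}. blinfun_apply (G (d i) - G (d (i - 1))) (xs i)) \<le> V * B"
proof -
  obtain V where V: "0 \<le> V"
    "\<And>d n xs B. subdivision a b d n \<Longrightarrow> 0 < B \<Longrightarrow> (\<And>i. norm (xs i) \<le> B) \<Longrightarrow>
      norm (\<Sum>i\<in>{1..n}. blinfun_apply (G (d i) - G (d (i - 1))) (xs i)) \<le> V * B"
    by (rule bounded_semivariationD[OF assms]) (rule that, assumption, simp)
  have "norm (\<Sum>i\<in>{1..n}. blinfun_apply (G (d i) - G (d (i - 1))) (xs i)) \<le> V * B"
    if c: "c \<le> b" and d: "subdivision a c d n" and B: "0 < B" and xs: "\<And>i. norm (xs i) \<le> B" for c d n xs B
  proof (cases "c = b")
    case True
    then show ?thesis using V(2)[of d n B xs, OF _ B xs] d by simp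
  next
    case False
    define d' where "d' = d(Suc n := b)"
    define xs' where "xs' = xs(Suc n := 0)"
    have "subdivision a b d' (Suc n)"
      using d c False by (auto simp: subdivision_def d'_def less_Suc_eq)
    moreover have "norm (xs' i) \<le> B" for i using xs B by (simp add: xs'_def)
    ultimately have "norm (\<Sum>i\<in>{1..Suc n}. blinfun_apply (G (d' i) - G (d' (i - 1))) (xs' i)) \<le> V * B"
      using V(2)[of d' "Suc n" B xs'] B by blast
    moreover have "(\<Sum>i\<in>{1..Suc n}. blinfun_apply (G (d' i) - G (d' (i - 1))) (xs' i))
       = (\<Sum>i\<in>{1..n}. blinfun_apply (G (d i) - G (d (i - 1))) (xs i))"
    proof -
      have "(\<Sum>i\<in>{1..Suc n}. blinfun_apply (G (d' i) - G (d' (i - 1))) (xs' i))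
        = (\<Sum>i\<in>{1..n}. blinfun_apply (G (d' i) - G (d' (i - 1))) (xs' i))"
        by (simp add: xs'_def)
      also have "\<dots> = (\<Sum>i\<in>{1..n}. blinfun_apply (G (d i) - G (d (i - 1))) (xs i))"
        by (rule sum.cong) (auto simp: xs'_def d'_def)
      finally show ?thesis .
    qed
    ultimately show ?thesis by simp
  qed
  with V(1) show thesis by (rule that)
qed

section \<open>Continuous approximation of step functions\<close>

instance bcontfun :: (metric_space, banach) banach ..

text \<open>As \<delta> decreases to 0, \<open>ramp \<delta> (\<tau> - c)\<close> tends to the
  indicator of \<tau> > c.\<close>

definition ramp :: "real \<Rightarrow> real \<Rightarrow> real" where
  "ramp \<delta> \<tau> = max 0 (min 1 (\<tau> / \<delta>))"

lemma ramp_range: "0 \<le> ramp \<delta> \<tau>" "ramp \<delta> \<tau> \<le> 1"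
  by (auto simp: ramp_def)

lemma ramp_mono: "0 < \<delta> \<Longrightarrow> a \<le> b \<Longrightarrow> ramp \<delta> a \<le> ramp \<delta> b"
  unfolding ramp_def using divide_right_mono[of a b \<delta>] by linarith

lemma ramp_continuous [continuous_intros]:
  "continuous_on U f \<Longrightarrow> continuous_on U (\<lambda>x. ramp \<delta> (f x))"
  unfolding ramp_def by (cases "\<delta> = 0") (auto intro!: continuous_intros)

lemma ramp_eq_0: "0 < \<delta> \<Longrightarrow> \<tau> \<le> 0 \<Longrightarrow> ramp \<delta> \<tau> = 0"
  using divide_nonpos_pos[of \<tau> \<delta>] by (simp add: ramp_def)

lemma ramp_eq_1: "0 < \<delta> \<Longrightarrow> \<delta> \<le> \<tau> \<Longrightarrow> ramp \<delta> \<tau> = 1"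
  by (simp add: ramp_def)

text \<open>Continuous substitute for the step function with value xs i on (d (i - 1), d i]: the
  weight of xs i, a difference of neighbouring ramps, tends to the indicator of that
  interval.\<close>

definition ramp_step :: "real \<Rightarrow> (nat \<Rightarrow> real) \<Rightarrow> nat \<Rightarrow> (nat \<Rightarrow> 'a::real_normed_vector) \<Rightarrow> real \<Rightarrow> 'a" where
  "ramp_step \<delta> d n xs \<tau> = (\<Sum>i\<in>{1..n}. (ramp \<delta> (\<tau> - d (i - 1)) - ramp \<delta> (\<tau> - d i)) *\<^sub>R xs i)"

lemma ramp_step_continuous: "continuous_on U (ramp_step \<delta> d n xs)"
  unfolding ramp_step_def by (intro continuous_intros)

lemma sum_telescope_down: "(\<Sum>i\<in>{1..n::nat}. f (i - 1) - f i) = f 0 - (f n :: real)"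
  by (induction n) auto

text \<open>The weights are nonnegative because the ramp is monotone, and they telescope to at most
  1; hence the bound is the same for every \<delta>.\<close>

lemma norm_ramp_step_le:
  assumes \<delta>: "0 < \<delta>" and d: "subdivision a b d n" and xs: "\<And>i. norm (xs i) \<le> 1"
  shows "norm (ramp_step \<delta> d n xs \<tau>) \<le> 1"
proof -
  have "norm (ramp_step \<delta> d n xs \<tau>) \<le> (\<Sum>i\<in>{1..n}. ramp \<delta> (\<tau> - d (i - 1)) - ramp \<delta> (\<tau> - d i))"
    unfolding ramp_step_def
  proof (rule sum_norm_le)
    fix i assume "i \<in> {1..n}"
    then have "d (i - 1) \<le> d i" by (intro subdivision_mono[OF d]) auto
    then have "ramp \<delta> (\<tau> - d i) \<le> ramp \<delta> (\<tau> - d (i - 1))" by (intro ramp_mono[OF \<delta>]) simp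
    then show "norm ((ramp \<delta> (\<tau> - d (i - 1)) - ramp \<delta> (\<tau> - d i)) *\<^sub>R xs i)
        \<le> ramp \<delta> (\<tau> - d (i - 1)) - ramp \<delta> (\<tau> - d i)"
      using xs[of i] by (simp add: mult_left_le)
  qed
  also have "\<dots> = ramp \<delta> (\<tau> - d 0) - ramp \<delta> (\<tau> - d n)" by (rule sum_telescope_down)
  also have "\<dots> \<le> 1" using ramp_range[of \<delta> "\<tau> - d 0"] ramp_range[of \<delta> "\<tau> - d n"] by linarith
  finally show ?thesis .
qed

section \<open>Resolvent families\<close>

locale resolvent_generator =
  fixes \<alpha> :: real and D :: "'a::banach set" and A :: "'a \<Rightarrow> 'a" and S :: "real \<Rightarrow> 'a \<Rightarrow>\<^sub>L 'a"
  assumes \<alpha>: "1 < \<alpha>" "\<alpha> < 2"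
    and A: "closed_dense_op D A"
    and R: "resolvent_family D A \<alpha> S"
begin

section \<open>Elementary properties of S and A\<close>

lemma S_0 [simp]: "S 0 = id_blinfun"
  using R by (simp add: resolvent_family_def)

lemma S_continuous: "T \<subseteq> {0..} \<Longrightarrow> continuous_on T (\<lambda>t. S t x)"
  using R continuous_on_subset unfolding resolvent_family_def by blast

lemma S_interval_continuous [continuous_intros]: "continuous_on {0..b} (\<lambda>t. S t x)"
  by (rule S_continuous) auto

lemma S_D: "0 \<le> t \<Longrightarrow> x \<in> D \<Longrightarrow> S t x \<in> D" "0 \<le> t \<Longrightarrow> x \<in> D \<Longrightarrow> A (S t x) = S t (A x)"
  using R by (auto simp: resolvent_family_def)

lemma S_resolvent: "0 \<le> t \<Longrightarrow> x \<in> D \<Longrightarrow> S t x = x + gconv \<alpha> (\<lambda>s. S s (A x)) t"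
  using R unfolding resolvent_family_def by blast

text \<open>Only orbits are known to be continuous; their boundedness on a compact interval becomes
  an operator norm bound by uniform boundedness.\<close>

lemma S_bound: obtains M where "0 < M" "\<And>t. t \<in> {0..b} \<Longrightarrow> norm (S t) \<le> M"
proof -
  have "\<exists>K. \<forall>t\<in>{0..b}. norm (S t x) \<le> K" for x
  proof -
    have "bounded ((\<lambda>t. S t x) ` {0..b})"
      by (intro compact_imp_bounded compact_continuous_image S_interval_continuous) simp
    then show ?thesis by (auto simp: bounded_iff)
  qed
  then obtain K where "\<forall>t\<in>{0..b}. norm (S t) \<le> K" using uniform_boundedness_principle[of "{0..b}" S] by blast
  then have "norm (S t) \<le> max 1 K" if "t \<in> {0..b}" for t using that by (simp add: le_max_iff_disj)
  moreover have "0 < max 1 K" by simp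
  ultimately show thesis using that by blast
qed

lemma D_subspace: "subspace D"
  using A by (simp add: closed_dense_op_def)

lemma A_add: "x \<in> D \<Longrightarrow> y \<in> D \<Longrightarrow> A (x + y) = A x + A y"
  and A_scaleR: "x \<in> D \<Longrightarrow> A (c *\<^sub>R x) = c *\<^sub>R A x"
  using A by (auto simp: closed_dense_op_def)

lemma A_0 [simp]: "A 0 = 0"
  using A_scaleR[of 0 0] subspace_0[OF D_subspace] by simp

lemma A_diff: "x \<in> D \<Longrightarrow> y \<in> D \<Longrightarrow> A (x - y) = A x - A y"
  using A_add[of x "- 1 *\<^sub>R y"] A_scaleR[of y "- 1"] subspace_scale[OF D_subspace, of y "- 1"] by simp

lemma A_sum:
  assumes "finite I" "\<And>i. i \<in> I \<Longrightarrow> x i \<in> D"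
  shows "(\<Sum>i\<in>I. x i) \<in> D" "A (\<Sum>i\<in>I. x i) = (\<Sum>i\<in>I. A (x i))"
proof -
  have "(\<Sum>i\<in>I. x i) \<in> D \<and> A (\<Sum>i\<in>I. x i) = (\<Sum>i\<in>I. A (x i))"
    using assms by (induction rule: finite_induct)
      (auto simp: A_add subspace_add[OF D_subspace] subspace_0[OF D_subspace])
  then show "(\<Sum>i\<in>I. x i) \<in> D" "A (\<Sum>i\<in>I. x i) = (\<Sum>i\<in>I. A (x i))" by auto
qed

lemma gconv_S_diff:
  "0 < \<beta> \<Longrightarrow> 0 \<le> t \<Longrightarrow> gconv \<beta> (\<lambda>s. S s (x - y)) t = gconv \<beta> (\<lambda>s. S s x) t - gconv \<beta> (\<lambda>s. S s y) t"
  by (simp add: blinfun.diff_right gconv_diff S_interval_continuous)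

lemma gconv_S_scaleR: "gconv \<beta> (\<lambda>s. S s (c *\<^sub>R x)) t = c *\<^sub>R gconv \<beta> (\<lambda>s. S s x) t"
  by (simp add: blinfun.scaleR_right gconv_scaleR)

lemma gconv_S_bound:
  assumes "0 < \<beta>"
  obtains K where "0 < K" "\<And>t x. t \<in> {0..b} \<Longrightarrow> norm (gconv \<beta> (\<lambda>s. S s x) t) \<le> K * norm x"
proof -
  obtain M where M: "0 < M" "\<And>t. t \<in> {0..b} \<Longrightarrow> norm (S t) \<le> M" using S_bound by blast
  have G: "0 < Gamma (\<beta> + 1)" using assms by simp
  define K where "K = b powr \<beta> / Gamma (\<beta> + 1) * M"
  have "norm (gconv \<beta> (\<lambda>s. S s x) t) \<le> (K + 1) * norm x" if t: "t \<in> {0..b}" for t x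
  proof -
    have "norm (gconv \<beta> (\<lambda>s. S s x) t) \<le> t powr \<beta> / Gamma (\<beta> + 1) * (M * norm x)"
    proof (rule norm_gconv_le)
      fix s assume "s \<in> {0..t}"
      then have "norm (S s) \<le> M" using M t by auto
      then show "norm (S s x) \<le> M * norm x"
        using norm_blinfun[of "S s" x] by (meson mult_right_mono norm_ge_zero order_trans)
    qed (use assms t in \<open>auto intro: S_interval_continuous\<close>)
    also have "\<dots> \<le> b powr \<beta> / Gamma (\<beta> + 1) * (M * norm x)"
      using t assms G M by (intro mult_right_mono divide_right_mono powr_mono2) auto
    also have "\<dots> \<le> (K + 1) * norm x" by (simp add: K_def algebra_simps)
    finally show ?thesis .
  qed
  moreover have "0 \<le> K" using M G by (simp add: K_def)
  ultimately show thesis using that[of "K + 1"] by simp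
qed

section \<open>The operators P(t) and integration against them\<close>

lemma Pop_diff: "0 \<le> t \<Longrightarrow> Pop \<alpha> S t (x - y) = Pop \<alpha> S t x - Pop \<alpha> S t y"
  using \<alpha> by (simp add: Pop_def gconv_S_diff)

lemma Pop_scaleR: "Pop \<alpha> S t (c *\<^sub>R x) = c *\<^sub>R Pop \<alpha> S t x"
  by (simp add: Pop_def gconv_S_scaleR)

lemma Pop_0 [simp]: "Pop \<alpha> S t 0 = 0"
  using Pop_scaleR[of t 0 0] by simp

lemma Pop_add: "0 \<le> t \<Longrightarrow> Pop \<alpha> S t (x + y) = Pop \<alpha> S t x + Pop \<alpha> S t y"
  using Pop_diff[of t x "- 1 *\<^sub>R y"] Pop_scaleR[of t "- 1" y] by simp

lemma Pop_bound:
  obtains K where "0 < K" "\<And>t x. t \<in> {0..b} \<Longrightarrow> norm (Pop \<alpha> S t x) \<le> K * norm x"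
  using gconv_S_bound[of "\<alpha> - 1" b] \<alpha> unfolding Pop_def by auto

lemma Pop_continuous: "continuous_on {0..b} (\<lambda>t. Pop \<alpha> S t x)"
  unfolding Pop_def using \<alpha> by (intro gconv_continuous S_interval_continuous) simp

lemma Pop_apply_continuous:
  assumes "continuous_on {0..b} g"
  shows "continuous_on {0..b} (\<lambda>s. Pop \<alpha> S s (g s))"
proof -
  obtain K where K: "\<And>t x. t \<in> {0..b} \<Longrightarrow> norm (Pop \<alpha> S t x) \<le> K * norm x" using Pop_bound by blast
  show ?thesis
    by (rule continuous_on_family_apply[where K = K, OF assms Pop_continuous])
       (use K in \<open>simp add: Pop_diff[symmetric]\<close>)
qed

text \<open>P * f with time reversed in f instead of in the kernel, see \<open>Pconv_eq_Lop\<close>.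
  In this form, freezing g on a subinterval turns the integral into an increment of \<open>Q\<close>
  applied to one vector.\<close>

definition Lop :: "real \<Rightarrow> (real \<Rightarrow> 'a) \<Rightarrow> 'a" where
  "Lop t g = integral {0..t} (\<lambda>s. Pop \<alpha> S s (g s))"

lemma Pconv_eq_Lop:
  assumes "continuous_on {0..t} f"
  shows "Pconv \<alpha> S f t = Lop t (\<lambda>s. f (t - s))"
proof -
  have "continuous_on {0..t} (\<lambda>s. f (t - s))"
    by (rule continuous_on_compose2[OF assms]) (auto intro!: continuous_intros)
  from integral_reflect_interval[OF Pop_apply_continuous[OF this]]
  show ?thesis by (simp add: Pconv_def Lop_def)
qed

lemma reflect_continuous:
  fixes f :: "real \<Rightarrow> 'b::topological_space"
  assumes "continuous_on {0..r} f" "t \<in> {0..r}"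
  shows "continuous_on {0..t} (\<lambda>s. f (t - s))"
  by (rule continuous_on_compose2[OF assms(1)]) (use assms(2) in \<open>auto intro!: continuous_intros\<close>)

lemma Lop_add:
  assumes "0 \<le> t" "continuous_on {0..t} f" "continuous_on {0..t} g"
  shows "Lop t (\<lambda>s. f s + g s) = Lop t f + Lop t g"
proof -
  have "Lop t (\<lambda>s. f s + g s) = integral {0..t} (\<lambda>s. Pop \<alpha> S s (f s) + Pop \<alpha> S s (g s))"
    unfolding Lop_def by (rule integral_cong) (simp add: Pop_add)
  also have "\<dots> = Lop t f + Lop t g"
    unfolding Lop_def using assms by (intro integral_add integrable_continuous_real Pop_apply_continuous)
  finally show ?thesis .
qed

lemma Lop_scaleR: "Lop t (\<lambda>s. c *\<^sub>R f s) = c *\<^sub>R Lop t f"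
  by (simp add: Lop_def Pop_scaleR)

lemma Lop_bound:
  obtains K where "0 < K"
    "\<And>t g B. t \<in> {0..b} \<Longrightarrow> continuous_on {0..t} g \<Longrightarrow> (\<And>s. s \<in> {0..t} \<Longrightarrow> norm (g s) \<le> B)
      \<Longrightarrow> norm (Lop t g) \<le> K * B"
proof -
  obtain K where K: "0 < K" "\<And>t x. t \<in> {0..b} \<Longrightarrow> norm (Pop \<alpha> S t x) \<le> K * norm x" using Pop_bound by blast
  have "norm (Lop t g) \<le> K * (\<bar>b\<bar> + 1) * B"
    if t: "t \<in> {0..b}" and g: "continuous_on {0..t} g" "\<And>s. s \<in> {0..t} \<Longrightarrow> norm (g s) \<le> B" for t g B
  proof -
    have B: "0 \<le> B" using g(2)[of 0] t by (auto intro: order_trans[OF norm_ge_zero])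
    have "norm (Lop t g) \<le> (K * B) * (t - 0)"
      unfolding Lop_def
    proof (rule integral_bound[OF _ Pop_apply_continuous[OF g(1)]])
      fix s assume s: "s \<in> {0..t}"
      then have "norm (Pop \<alpha> S s (g s)) \<le> K * norm (g s)" using t by (intro K(2)) auto
      also have "\<dots> \<le> K * B" using g(2)[OF s] K(1) by simp
      finally show "norm (Pop \<alpha> S s (g s)) \<le> K * B" .
    qed (use t in simp)
    also have "\<dots> \<le> (K * B) * (\<bar>b\<bar> + 1)" using t K B by (intro mult_left_mono) auto
    finally show ?thesis by (simp add: ac_simps)
  qed
  then show thesis using that[of "K * (\<bar>b\<bar> + 1)"] K(1) by simp
qed

section \<open>The integrated family Q = g_\<alpha> * S\<close>

definition Q :: "real \<Rightarrow> 'a \<Rightarrow> 'a" where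
  "Q t x = gconv \<alpha> (\<lambda>s. S s x) t"

lemma Q_0 [simp]: "Q 0 x = 0"
  by (simp add: Q_def)

lemma Q_diff: "0 \<le> t \<Longrightarrow> Q t (x - y) = Q t x - Q t y"
  using \<alpha> by (simp add: Q_def gconv_S_diff)

lemma Q_bound:
  obtains K where "0 < K" "\<And>t x. t \<in> {0..b} \<Longrightarrow> norm (Q t x) \<le> K * norm x"
  using gconv_S_bound[of \<alpha> b] \<alpha> unfolding Q_def by auto

lemma Q_continuous: "continuous_on {0..b} (\<lambda>t. Q t x)"
  unfolding Q_def using \<alpha> by (intro gconv_continuous S_interval_continuous) simp

text \<open>The semigroup law with 1 + (\<alpha> - 1) = \<alpha>.\<close>

lemma Q_eq_integral: "0 \<le> t \<Longrightarrow> Q t x = integral {0..t} (\<lambda>s. Pop \<alpha> S s x)"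
  using gconv_gconv[of 1 "\<alpha> - 1" t "\<lambda>s. S s x"] \<alpha>
  by (simp add: Q_def gconv_1 Pop_def[abs_def] S_interval_continuous)

lemma integral_Pop:
  assumes "0 \<le> a" "a \<le> b"
  shows "integral {a..b} (\<lambda>s. Pop \<alpha> S s x) = Q b x - Q a x"
  using Henstock_Kurzweil_Integration.integral_combine[of 0 a b "\<lambda>s. Pop \<alpha> S s x"] assms
    integrable_continuous_real[OF Pop_continuous[of b x]] Q_eq_integral[of a x] Q_eq_integral[of b x]
  by (simp add: algebra_simps)

text \<open>On D, A moves under the convolution and the resolvent equation applies. The expression S
  t x - x no longer contains A, so it converges along sequences from D, and closedness reaches every
  x.\<close>

lemma Q_D:
  assumes t: "0 \<le> t"
  shows "Q t x \<in> D" "A (Q t x) = S t x - x"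
proof -
  have *: "Q t y \<in> D \<and> A (Q t y) = S t y - y" if y: "y \<in> D" for y
  proof -
    have eq: "A (S s y) = S s (A y)" if "s \<in> {0..t}" for s using S_D y that by auto
    have c: "continuous_on {0..t} (\<lambda>s. A (S s y))"
      by (rule continuous_on_eq[OF S_interval_continuous[of _ "A y"]]) (use eq in auto)
    have "gconv \<alpha> (\<lambda>s. S s y) t \<in> D \<and> A (gconv \<alpha> (\<lambda>s. S s y) t) = gconv \<alpha> (\<lambda>s. A (S s y)) t"
      using closed_op_gconv[OF A _ t _ S_interval_continuous c, of \<alpha>] \<alpha> S_D y by auto
    moreover have "gconv \<alpha> (\<lambda>s. A (S s y)) t = gconv \<alpha> (\<lambda>s. S s (A y)) t"
      by (rule gconv_cong) (rule eq)
    ultimately show ?thesis using S_resolvent[OF t y] by (simp add: Q_def)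
  qed
  have "x \<in> closure D" using A by (simp add: closed_dense_op_def)
  then obtain y where y: "\<And>n. y n \<in> D" "y \<longlonglongrightarrow> x" by (auto simp: closure_sequential)
  obtain K where K: "\<And>x. norm (Q t x) \<le> K * norm x"
    using Q_bound[of t] t by (metis atLeastAtMost_iff order_refl)
  have "(\<lambda>n. Q t (y n) - Q t x) \<longlonglongrightarrow> 0"
  proof (rule Lim_null_comparison)
    show "\<forall>\<^sub>F n in sequentially. norm (Q t (y n) - Q t x) \<le> K * norm (y n - x)"
      using K t by (simp add: Q_diff[symmetric])
    show "(\<lambda>n. K * norm (y n - x)) \<longlonglongrightarrow> 0"
      using y(2) by (intro tendsto_mult_right_zero tendsto_norm_zero) (simp add: LIM_zero_iff)
  qed
  then have "(\<lambda>n. Q t (y n)) \<longlonglongrightarrow> Q t x" by (simp add: LIM_zero_iff)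
  moreover have "(\<lambda>n. S t (y n) - y n) \<longlonglongrightarrow> S t x - x"
    using y(2) by (intro tendsto_intros)
  then have "(\<lambda>n. A (Q t (y n))) \<longlonglongrightarrow> S t x - x" using * y(1) by simp
  ultimately show "Q t x \<in> D" "A (Q t x) = S t x - x"
    using closed_op_limit[OF A, of "\<lambda>n. Q t (y n)"] * y(1) by blast+
qed

section \<open>Bounded approximations of A and Riemann sums\<close>

text \<open>Since S h p - p = Q h (A p) for p in D, with Q h of order h powr \<alpha>, these bounded
  operators approximate A.\<close>

definition Aapprox :: "real \<Rightarrow> 'a \<Rightarrow>\<^sub>L 'a" where
  "Aapprox h = (Gamma (\<alpha> + 1) / h powr \<alpha>) *\<^sub>R (S h - id_blinfun)"

text \<open>The normalising factor is the reciprocal of (g_\<alpha> * 1)(h) = h^\<alpha> /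
  Gamma(\<alpha> + 1); it turns the convolution in the resolvent equation into a mean.\<close>

lemma Aapprox_D:
  assumes "0 < h" "p \<in> D"
  shows "Aapprox h p = gavg \<alpha> (\<lambda>s. S s (A p)) h"
proof -
  have "S h p - p = (h powr \<alpha> / Gamma (\<alpha> + 1)) *\<^sub>R gavg \<alpha> (\<lambda>s. S s (A p)) h"
    using S_resolvent[of h p] gconv_eq_gavg[of \<alpha> h "\<lambda>s. S s (A p)"] assms \<alpha>
    by (simp add: S_interval_continuous)
  moreover have "Gamma (\<alpha> + 1) > 0" using \<alpha> by simp
  ultimately show ?thesis
    using assms by (simp add: Aapprox_def blinfun.scaleR_left blinfun.diff_left)
qed

text \<open>The mean of S s (A p) over [0,h] is continuous in h down to 0, where it equals S 0 (A
  p).\<close>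

lemma Aapprox_tendsto:
  assumes "p \<in> D"
  shows "(\<lambda>n. Aapprox (inverse (real (Suc n))) p) \<longlonglongrightarrow> A p"
proof -
  have "continuous_on {0..1} (gavg \<alpha> (\<lambda>s. S s (A p)))"
    using \<alpha> by (intro gavg_continuous S_interval_continuous) simp
  then have "(\<lambda>n. gavg \<alpha> (\<lambda>s. S s (A p)) (inverse (real (Suc n)))) \<longlonglongrightarrow> gavg \<alpha> (\<lambda>s. S s (A p)) 0"
    by (rule continuous_on_tendsto_compose[OF _ LIMSEQ_inverse_real_of_nat])
       (auto intro!: always_eventually simp: inverse_eq_divide)
  moreover have "gavg \<alpha> (\<lambda>s. S s (A p)) 0 = A p" by (simp add: gavg_def)
  ultimately show ?thesis using assms by (simp add: Aapprox_D)
qed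

text \<open>A mean of S s (A p) is bounded through the supremum of norm (S s) on [0,1], hence
  uniformly in h. Bounds on A p can thus be handed to bounded operators before a limit is
  taken.\<close>

lemma Aapprox_bound:
  obtains M where "0 < M" "\<And>h p. 0 < h \<Longrightarrow> h \<le> 1 \<Longrightarrow> p \<in> D \<Longrightarrow> norm (Aapprox h p) \<le> M * norm (A p)"
proof -
  obtain M where M: "0 < M" "\<And>t. t \<in> {0..1} \<Longrightarrow> norm (S t) \<le> M" using S_bound by blast
  have "norm (Aapprox h p) \<le> M * norm (A p)" if h: "0 < h" "h \<le> 1" and p: "p \<in> D" for h p
    unfolding Aapprox_D[OF h(1) p]
  proof (rule norm_gavg_le)
    fix s assume "s \<in> {0..h}"
    then have "norm (S s) \<le> M" using M h by auto
    then show "norm (S s (A p)) \<le> M * norm (A p)"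
      using norm_blinfun[of "S s" "A p"] by (meson mult_right_mono norm_ge_zero order_trans)
  qed (use \<alpha> h in \<open>auto intro: S_interval_continuous\<close>)
  then show thesis using that M(1) by blast
qed

lemma Riemann_sum_tendsto:
  assumes t: "0 < t" and g: "continuous_on {0..t} g"
  shows "(\<lambda>N. \<Sum>i\<in>{1..Suc N}. Q (t * real i / real (Suc N)) (g (t * real i / real (Suc N)))
      - Q (t * real (i - 1) / real (Suc N)) (g (t * real i / real (Suc N)))) \<longlonglongrightarrow> Lop t g"
proof (rule tendstoI)
  fix e :: real assume e: "0 < e"
  obtain K where K: "0 < K" "\<And>s x. s \<in> {0..t} \<Longrightarrow> norm (Pop \<alpha> S s x) \<le> K * norm x"
    using Pop_bound by blast
  \<comment> \<open>Makes the total error K * \<epsilon> * t equal to e / 2.\<close>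
  define \<epsilon> where "\<epsilon> = e / (2 * K * t)"
  have \<epsilon>: "0 < \<epsilon>" using e K t by (simp add: \<epsilon>_def)
  have "uniformly_continuous_on {0..t} g" using compact_uniformly_continuous[OF g] by simp
  then obtain \<delta> where \<delta>: "0 < \<delta>"
    "\<And>a b. a \<in> {0..t} \<Longrightarrow> b \<in> {0..t} \<Longrightarrow> dist b a < \<delta> \<Longrightarrow> dist (g b) (g a) < \<epsilon>"
    using \<epsilon> unfolding uniformly_continuous_on_def by metis
  obtain N0 :: nat where N0: "t / \<delta> < real N0" using reals_Archimedean2 by blast
  show "\<forall>\<^sub>F N in sequentially. dist (\<Sum>i\<in>{1..Suc N}. Q (t * real i / real (Suc N)) (g (t * real i / real (Suc N)))
      - Q (t * real (i - 1) / real (Suc N)) (g (t * real i / real (Suc N)))) (Lop t g) < e"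
  proof (rule eventually_sequentiallyI[of N0])
    fix N assume N: "N0 \<le> N"
    define n where "n = Suc N"
    define d where "d i = t * real i / real n" for i
    have n: "0 < real n" by (simp add: n_def)
    have "t / \<delta> < real n" using N N0 by (simp add: n_def)
    then have mesh: "t / real n < \<delta>" using \<delta>(1) n by (simp add: field_simps)
    have d0: "d 0 = 0" "d n = t" using n by (simp_all add: d_def)
    have dS: "d i - d (i - 1) = t / real n" if "i \<in> {1..n}" for i
      using that n by (simp add: d_def of_nat_diff field_simps)
    have dr: "0 \<le> d (i - 1)" "d (i - 1) \<le> d i" "d i \<le> t" if "i \<in> {1..n}" for i
    proof -
      show "0 \<le> d (i - 1)" using t by (simp add: d_def)
      show "d (i - 1) \<le> d i" using t n by (simp add: d_def divide_right_mono)
      have "t * real i \<le> t * real n" using that t by simp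
      then show "d i \<le> t" using n by (simp add: d_def field_simps)
    qed
    have L: "Lop t g = (\<Sum>i\<in>{1..n}. integral {d (i - 1)..d i} (\<lambda>s. Pop \<alpha> S s (g s)))"
      using integral_partition[of d n "\<lambda>s. Pop \<alpha> S s (g s)"] Pop_apply_continuous[OF g] d0 t n
      by (simp add: Lop_def d_def divide_right_mono)
    have each: "norm ((Q (d i) (g (d i)) - Q (d (i - 1)) (g (d i)))
        - integral {d (i - 1)..d i} (\<lambda>s. Pop \<alpha> S s (g s))) \<le> K * \<epsilon> * (t / real n)"
      if i: "i \<in> {1..n}" for i
    proof -
      note dr = dr[OF i]
      have sub: "{d (i - 1)..d i} \<subseteq> {0..t}" using dr by auto
      have c1: "continuous_on {d (i - 1)..d i} (\<lambda>s. Pop \<alpha> S s (g (d i)))"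
        and c2: "continuous_on {d (i - 1)..d i} (\<lambda>s. Pop \<alpha> S s (g s))"
        using Pop_continuous Pop_apply_continuous[OF g] continuous_on_subset sub by blast+
      have "(Q (d i) (g (d i)) - Q (d (i - 1)) (g (d i))) - integral {d (i - 1)..d i} (\<lambda>s. Pop \<alpha> S s (g s))
          = integral {d (i - 1)..d i} (\<lambda>s. Pop \<alpha> S s (g (d i)) - Pop \<alpha> S s (g s))"
        using dr c1 c2 by (simp add: integral_Pop integral_diff integrable_continuous_real)
      also have "norm \<dots> \<le> (K * \<epsilon>) * (d i - d (i - 1))"
      proof (rule integral_bound[OF dr(2)])
        show "continuous_on {d (i - 1)..d i} (\<lambda>s. Pop \<alpha> S s (g (d i)) - Pop \<alpha> S s (g s))"
          using c1 c2 by (rule continuous_on_diff)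
        fix s assume s: "s \<in> {d (i - 1)..d i}"
        then have st: "s \<in> {0..t}" "d i \<in> {0..t}" using sub dr by auto
        have "dist (d i) s < \<delta>" using s dS[OF i] mesh by (auto simp: dist_real_def)
        then have gd: "norm (g (d i) - g s) < \<epsilon>" using \<delta>(2)[OF st] by (simp add: dist_norm)
        have "norm (Pop \<alpha> S s (g (d i)) - Pop \<alpha> S s (g s)) \<le> K * norm (g (d i) - g s)"
          using K(2)[OF st(1), of "g (d i) - g s"] st by (simp add: Pop_diff)
        also have "\<dots> \<le> K * \<epsilon>" using gd K(1) by simp
        finally show "norm (Pop \<alpha> S s (g (d i)) - Pop \<alpha> S s (g s)) \<le> K * \<epsilon>" .
      qed
      finally show ?thesis using dS[OF i] by simp
    qed
    have "norm ((\<Sum>i\<in>{1..n}. Q (d i) (g (d i)) - Q (d (i - 1)) (g (d i))) - Lop t g)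
        \<le> (\<Sum>i\<in>{1..n}. K * \<epsilon> * (t / real n))"
      unfolding L sum_subtractf[symmetric] by (rule sum_norm_le) (use each in auto)
    also have "\<dots> = K * \<epsilon> * t" using n by simp
    also have "\<dots> < e" using e K t by (simp add: \<epsilon>_def)
    finally show "dist (\<Sum>i\<in>{1..Suc N}. Q (t * real i / real (Suc N)) (g (t * real i / real (Suc N)))
      - Q (t * real (i - 1) / real (Suc N)) (g (t * real i / real (Suc N)))) (Lop t g) < e"
      by (simp only: dist_norm n_def d_def)
  qed
qed

subsection \<open>Bounded semivariation implies solvability\<close>

lemma Pconv_bound:
  obtains K where "0 < K"
    "\<And>t f B. t \<in> {0..r} \<Longrightarrow> continuous_on {0..r} f \<Longrightarrow> (\<And>s. s \<in> {0..r} \<Longrightarrow> norm (f s) \<le> B)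
      \<Longrightarrow> norm (Pconv \<alpha> S f t) \<le> K * B"
proof -
  obtain K where K: "0 < K"
    "\<And>t g B. t \<in> {0..r} \<Longrightarrow> continuous_on {0..t} g \<Longrightarrow> (\<And>s. s \<in> {0..t} \<Longrightarrow> norm (g s) \<le> B)
      \<Longrightarrow> norm (Lop t g) \<le> K * B"
    by (rule Lop_bound[of r]) (rule that, assumption, simp)
  have "norm (Pconv \<alpha> S f t) \<le> K * B"
    if t: "t \<in> {0..r}" and f: "continuous_on {0..r} f" and B: "\<And>s. s \<in> {0..r} \<Longrightarrow> norm (f s) \<le> B" for t f B
  proof -
    have "Pconv \<alpha> S f t = Lop t (\<lambda>s. f (t - s))"
      by (rule Pconv_eq_Lop[OF continuous_on_subset[OF f]]) (use t in auto)
    then show ?thesis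
      using K(2)[OF t reflect_continuous[OF f t], of B] B t by simp
  qed
  with K(1) show thesis by (rule that)
qed

lemma Pconv_add:
  assumes "t \<in> {0..r}" "continuous_on {0..r} f" "continuous_on {0..r} g"
  shows "Pconv \<alpha> S (\<lambda>s. f s + g s) t = Pconv \<alpha> S f t + Pconv \<alpha> S g t"
proof -
  have c: "continuous_on {0..t} f" "continuous_on {0..t} g"
    by (rule continuous_on_subset[OF assms(2)], use assms(1) in auto,
        rule continuous_on_subset[OF assms(3)], use assms(1) in auto)
  then show ?thesis
    using assms(1) Lop_add[OF _ reflect_continuous[OF assms(2,1)] reflect_continuous[OF assms(3,1)]]
    by (simp add: Pconv_eq_Lop continuous_on_add)
qed

lemma Pconv_scaleR: "Pconv \<alpha> S (\<lambda>s. c *\<^sub>R f s) t = c *\<^sub>R Pconv \<alpha> S f t"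
  by (simp add: Pconv_def Pop_scaleR)

lemma Pconv_diff:
  assumes "t \<in> {0..r}" "continuous_on {0..r} f" "continuous_on {0..r} g"
  shows "Pconv \<alpha> S (\<lambda>s. f s - g s) t = Pconv \<alpha> S f t - Pconv \<alpha> S g t"
  using Pconv_add[OF assms(1,2), of "\<lambda>s. (- 1) *\<^sub>R g s"] Pconv_scaleR[of "- 1" g t] assms(3)
  by (simp add: continuous_on_minus)

lemma Pconv_0 [simp]: "Pconv \<alpha> S f 0 = 0"
  by (simp add: Pconv_def)

text \<open>The Riemann sums of P * f are mapped by A to sums over increments of S, which the
  semivariation controls. The bounded operators Aapprox carry this bound to the limit.\<close>

lemma A_Pconv_bound:
  assumes sv: "bounded_semivariation S 0 r"
  obtains C where "0 \<le> C"
    "\<And>t f B. t \<in> {0..r} \<Longrightarrow> continuous_on {0..r} f \<Longrightarrow> 0 < B \<Longrightarrow> (\<And>s. s \<in> {0..r} \<Longrightarrow> norm (f s) \<le> B)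
      \<Longrightarrow> Pconv \<alpha> S f t \<in> D \<Longrightarrow> norm (A (Pconv \<alpha> S f t)) \<le> C * B"
proof -
  obtain V where V: "0 \<le> V"
    "\<And>c d n xs B. c \<le> r \<Longrightarrow> subdivision 0 c d n \<Longrightarrow> 0 < B \<Longrightarrow> (\<And>i. norm (xs i) \<le> B) \<Longrightarrow>
      norm (\<Sum>i\<in>{1..n}. blinfun_apply (S (d i) - S (d (i - 1))) (xs i)) \<le> V * B"
    by (rule bounded_semivariation_initial[OF sv]) (rule that, assumption, simp)
  obtain M where M: "0 < M" "\<And>h p. 0 < h \<Longrightarrow> h \<le> 1 \<Longrightarrow> p \<in> D \<Longrightarrow> norm (Aapprox h p) \<le> M * norm (A p)"
    by (rule Aapprox_bound) (rule that, assumption, simp)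
  have "norm (A (Pconv \<alpha> S f t)) \<le> (M * V) * B"
    if t: "t \<in> {0..r}" and f: "continuous_on {0..r} f" and B: "0 < B" "\<And>s. s \<in> {0..r} \<Longrightarrow> norm (f s) \<le> B"
      and fD: "Pconv \<alpha> S f t \<in> D" for t f B
  proof (cases "t = 0")
    case True
    then show ?thesis using M V B by simp
  next
    case False
    with t have t0: "0 < t" by simp
    define g where "g s = f (t - s)" for s
    have g: "continuous_on {0..t} g" unfolding g_def by (rule reflect_continuous[OF f t])
    have L: "Pconv \<alpha> S f t = Lop t g"
      unfolding g_def by (rule Pconv_eq_Lop[OF continuous_on_subset[OF f]]) (use t in auto)
    define p where "p N = (\<Sum>i\<in>{1..Suc N}. Q (t * real i / real (Suc N)) (g (t * real i / real (Suc N)))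
      - Q (t * real (i - 1) / real (Suc N)) (g (t * real i / real (Suc N))))" for N
    have p_lim: "p \<longlonglongrightarrow> Pconv \<alpha> S f t"
      unfolding L using Riemann_sum_tendsto[OF t0 g] by (simp add: p_def[abs_def])
    have p: "p N \<in> D \<and> norm (A (p N)) \<le> V * B" for N
    proof -
      define d where "d i = t * real i / real (Suc N)" for i
      \<comment> \<open>Cut off to 0 outside the sum, since the semivariation bound asks for norm
        (xs i) \<le> B at every index.\<close>
      define xs where "xs i = (if i \<in> {1..Suc N} then g (d i) else 0)" for i
      have d0: "0 \<le> d i" for i using t0 by (simp add: d_def)
      have "subdivision 0 t d (Suc N)"
        using t0 by (auto simp: subdivision_def d_def divide_strict_right_mono)
      moreover have "norm (xs i) \<le> B" for i
      proof (cases "i \<in> {1..Suc N}")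
        case True
        then have "t * real i \<le> t * real (Suc N)" using t0 by (intro mult_left_mono) auto
        then have "d i \<le> t" by (simp add: d_def field_simps)
        then have "t - d i \<in> {0..r}" using d0[of i] t by auto
        then show ?thesis using B(2) by (simp add: xs_def g_def B(1) less_imp_le)
      qed (use B(1) in \<open>auto simp: xs_def\<close>)
      ultimately have le: "norm (\<Sum>i\<in>{1..Suc N}. blinfun_apply (S (d i) - S (d (i - 1))) (xs i)) \<le> V * B"
        using V(2)[of t d "Suc N" B xs] t B(1) by auto
      have inc: "Q (d i) (xs i) - Q (d (i - 1)) (xs i) \<in> D"
        "A (Q (d i) (xs i) - Q (d (i - 1)) (xs i)) = blinfun_apply (S (d i) - S (d (i - 1))) (xs i)" for i
        using Q_D[OF d0] by (auto simp: A_diff subspace_diff[OF D_subspace] blinfun.diff_left)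
      have "p N = (\<Sum>i\<in>{1..Suc N}. Q (d i) (xs i) - Q (d (i - 1)) (xs i))"
        unfolding p_def by (rule sum.cong) (simp_all add: xs_def d_def)
      moreover from A_sum[of "{1..Suc N}" "\<lambda>i. Q (d i) (xs i) - Q (d (i - 1)) (xs i)", OF finite_atLeastAtMost inc(1)]
      have "(\<Sum>i\<in>{1..Suc N}. Q (d i) (xs i) - Q (d (i - 1)) (xs i)) \<in> D"
        "norm (A (\<Sum>i\<in>{1..Suc N}. Q (d i) (xs i) - Q (d (i - 1)) (xs i))) \<le> V * B"
        using le by (simp_all only: inc(2))
      ultimately show ?thesis by (simp only: simp_thms)
    qed
    \<comment> \<open>With h fixed, \<open>Aapprox h\<close> is continuous and N may tend to
      infinity; h tends to 0 only afterwards, and there membership of P * f in D enters.\<close>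
    have bd: "norm (Aapprox h (Pconv \<alpha> S f t)) \<le> M * V * B" if h: "0 < h" "h \<le> 1" for h
    proof (rule LIMSEQ_le_const2)
      show "(\<lambda>N. norm (Aapprox h (p N))) \<longlonglongrightarrow> norm (Aapprox h (Pconv \<alpha> S f t))"
        by (intro tendsto_intros p_lim)
      have "norm (Aapprox h (p N)) \<le> M * V * B" for N
        using M(2)[OF h, of "p N"] p[of N] M(1) by (smt (verit) mult.assoc mult_left_mono)
      then show "\<exists>n. \<forall>N\<ge>n. norm (Aapprox h (p N)) \<le> M * V * B" by blast
    qed
    show ?thesis
    proof (rule LIMSEQ_le_const2)
      show "(\<lambda>n. norm (Aapprox (inverse (real (Suc n))) (Pconv \<alpha> S f t))) \<longlonglongrightarrow> norm (A (Pconv \<alpha> S f t))"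
        by (intro tendsto_norm Aapprox_tendsto fD)
      show "\<exists>n. \<forall>N\<ge>n. norm (Aapprox (inverse (real (Suc N))) (Pconv \<alpha> S f t)) \<le> M * V * B"
        using bd by (auto simp: inverse_le_1_iff)
    qed
  qed
  moreover have "0 \<le> M * V" using M V by simp
  ultimately show thesis using that[of "M * V"] by simp
qed

text \<open>For a solution u = P * f with zero initial data, h is the Caputo derivative A u + f of u.\<close>

definition regular :: "real \<Rightarrow> (real \<Rightarrow> 'a) \<Rightarrow> (real \<Rightarrow> 'a) \<Rightarrow> bool" where
  "regular r f h \<longleftrightarrow> continuous_on {0..r} h \<and>
     (\<forall>t\<in>{0..r}. Pconv \<alpha> S f t = gconv \<alpha> h t \<and> gconv \<alpha> h t \<in> D \<and> A (gconv \<alpha> h t) = h t - f t)"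

text \<open>P * s^k x = k! g_(\<alpha>+k) * S x, so h = k! g_k * S x works: under the integral, A
  turns g_k * Q x into g_k * (S x - x), and k! g_k * 1 = t^k.\<close>

lemma regular_monomial: "\<exists>h. regular r (\<lambda>s. s ^ k *\<^sub>R x) h"
proof -
  have P: "Pconv \<alpha> S (\<lambda>s. s ^ k *\<^sub>R x) t = fact k *\<^sub>R gconv (\<alpha> + real k) (\<lambda>s. S s x) t" if t: "0 \<le> t" for t
  proof -
    have "Pconv \<alpha> S (\<lambda>s. s ^ k *\<^sub>R x) t = Lop t (\<lambda>s. (t - s) ^ k *\<^sub>R x)"
      by (rule Pconv_eq_Lop) (intro continuous_intros)
    also have "\<dots> = integral {0..t} (\<lambda>s. (t - s) ^ k *\<^sub>R Pop \<alpha> S s x)"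
      by (simp add: Lop_def Pop_scaleR)
    also have "\<dots> = gconv (real k + 1) (\<lambda>s. fact k *\<^sub>R Pop \<alpha> S s x) t"
      unfolding gconv_def by (rule integral_spike[of "{t}"]) (auto simp: power_eq_gk)
    also have "\<dots> = fact k *\<^sub>R gconv (real k + 1) (gconv (\<alpha> - 1) (\<lambda>s. S s x)) t"
      by (simp only: gconv_scaleR Pop_def)
    also have "gconv (real k + 1) (gconv (\<alpha> - 1) (\<lambda>s. S s x)) t = gconv (real k + 1 + (\<alpha> - 1)) (\<lambda>s. S s x) t"
      using \<alpha> t by (intro gconv_gconv S_interval_continuous) auto
    finally show ?thesis by (simp add: add.commute)
  qed
  show ?thesis
  \<comment> \<open>k = 0 stands apart because g_0 would be the Dirac kernel; there h is the orbit
    of x.\<close>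
  proof (cases "k = 0")
    case True
    have "regular r (\<lambda>s. s ^ k *\<^sub>R x) (\<lambda>s. S s x)"
      unfolding regular_def using True P Q_D by (auto simp: Q_def intro: S_interval_continuous)
    then show ?thesis by blast
  next
    case False
    then have k: "0 < real k" by simp
    define h where "h = (\<lambda>s. fact k *\<^sub>R gconv (real k) (\<lambda>s. S s x) s)"
    have "continuous_on {0..r} h"
      unfolding h_def using k by (intro continuous_intros gconv_continuous S_interval_continuous)
    moreover have "Pconv \<alpha> S (\<lambda>s. s ^ k *\<^sub>R x) t = gconv \<alpha> h t \<and> gconv \<alpha> h t \<in> D \<and>
        A (gconv \<alpha> h t) = h t - t ^ k *\<^sub>R x" if "t \<in> {0..r}" for t
    proof -
      have t: "0 \<le> t" using that by simp
      have h: "gconv \<alpha> h t = fact k *\<^sub>R gconv (\<alpha> + real k) (\<lambda>s. S s x) t"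
        unfolding h_def gconv_scaleR using gconv_gconv[of \<alpha> "real k" t "\<lambda>s. S s x"] \<alpha> k t
        by (simp add: S_interval_continuous)
      \<comment> \<open>The other order of the two kernels puts \<open>Q\<close> inside, where A can
        be applied pointwise.\<close>
      have "gconv (\<alpha> + real k) (\<lambda>s. S s x) t = gconv (real k) (gconv \<alpha> (\<lambda>s. S s x)) t"
        using gconv_gconv[of "real k" \<alpha> t "\<lambda>s. S s x"] \<alpha> k t
        by (simp add: S_interval_continuous add.commute)
      also have "\<dots> = gconv (real k) (\<lambda>s. Q s x) t" by (simp add: Q_def)
      finally have eq: "gconv (\<alpha> + real k) (\<lambda>s. S s x) t = gconv (real k) (\<lambda>s. Q s x) t" .
      have AQ: "A (Q s x) = S s x - x" if "s \<in> {0..t}" for s using Q_D that by simp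
      have cS: "continuous_on {0..t} (\<lambda>s. S s x - x)"
        by (intro continuous_on_diff S_interval_continuous continuous_on_const)
      have cA: "continuous_on {0..t} (\<lambda>s. A (Q s x))"
        by (rule continuous_on_eq[OF cS]) (use AQ in auto)
      have "gconv (real k) (\<lambda>s. Q s x) t \<in> D"
        "A (gconv (real k) (\<lambda>s. Q s x) t) = gconv (real k) (\<lambda>s. A (Q s x)) t"
        using closed_op_gconv[OF A k t _ Q_continuous cA] Q_D by auto
      moreover have "gconv (real k) (\<lambda>s. A (Q s x)) t = gconv (real k) (\<lambda>s. S s x - x) t"
        by (rule gconv_cong) (rule AQ)
      moreover have "gconv (real k) (\<lambda>s. S s x - x) t
          = gconv (real k) (\<lambda>s. S s x) t - gconv (real k) (\<lambda>s. s ^ 0 *\<^sub>R x) t"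
        using gconv_diff[OF k t S_interval_continuous continuous_on_const] by simp
      moreover have "fact k *\<^sub>R gconv (real k) (\<lambda>s. s ^ 0 *\<^sub>R x) t = t ^ k *\<^sub>R x"
        using gconv_power[OF k, of 0 x t] power_eq_gk[of t k] t False
        by (cases "t = 0") (simp_all add: gk_def)
      ultimately show ?thesis
        using P[OF t] h eq by (simp add: A_scaleR subspace_scale[OF D_subspace] h_def scaleR_diff_right)
    qed
    ultimately have "regular r (\<lambda>s. s ^ k *\<^sub>R x) h" by (simp add: regular_def)
    then show ?thesis by blast
  qed
qed

lemma regular_add:
  assumes f: "continuous_on {0..r} f" "continuous_on {0..r} g" and "regular r f h" "regular r g k"
  shows "regular r (\<lambda>s. f s + g s) (\<lambda>s. h s + k s)"
  unfolding regular_def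
proof (intro conjI ballI)
  note reg = assms(3,4)[unfolded regular_def]
  show "continuous_on {0..r} (\<lambda>s. h s + k s)" using reg by (intro continuous_on_add) auto
  fix t assume t: "t \<in> {0..r}"
  have "continuous_on {0..t} h" "continuous_on {0..t} k"
    using reg t by (auto intro: continuous_on_subset)
  then have eq: "gconv \<alpha> (\<lambda>s. h s + k s) t = gconv \<alpha> h t + gconv \<alpha> k t"
    using \<alpha> t by (intro gconv_add) auto
  show "Pconv \<alpha> S (\<lambda>s. f s + g s) t = gconv \<alpha> (\<lambda>s. h s + k s) t"
    using Pconv_add[OF t f] reg t eq by simp
  show "gconv \<alpha> (\<lambda>s. h s + k s) t \<in> D"
    unfolding eq using reg t by (intro subspace_add[OF D_subspace]) auto
  show "A (gconv \<alpha> (\<lambda>s. h s + k s) t) = h t + k t - (f t + g t)"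
    unfolding eq using reg t by (simp add: A_add)
qed

text \<open>P * (F m - F n) lies in D as a difference of elements of D, so the a priori bound
  applies to it and makes \<open>H\<close> uniformly Cauchy. Closedness of A then handles the
  limit.\<close>

lemma regular_limit:
  assumes sv: "bounded_semivariation S 0 r"
    and F: "\<And>n. continuous_on {0..r} (F n)" and f: "continuous_on {0..r} f"
    and reg: "\<And>n. regular r (F n) (H n)" and lim: "uniform_limit {0..r} F f sequentially"
  shows "\<exists>h. regular r f h"
proof -
  obtain C where C: "0 \<le> C"
    "\<And>t f B. t \<in> {0..r} \<Longrightarrow> continuous_on {0..r} f \<Longrightarrow> 0 < B \<Longrightarrow> (\<And>s. s \<in> {0..r} \<Longrightarrow> norm (f s) \<le> B)
      \<Longrightarrow> Pconv \<alpha> S f t \<in> D \<Longrightarrow> norm (A (Pconv \<alpha> S f t)) \<le> C * B"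
    by (rule A_Pconv_bound[OF sv]) (rule that, assumption, simp)
  obtain K where K: "0 < K"
    "\<And>t f B. t \<in> {0..r} \<Longrightarrow> continuous_on {0..r} f \<Longrightarrow> (\<And>s. s \<in> {0..r} \<Longrightarrow> norm (f s) \<le> B)
      \<Longrightarrow> norm (Pconv \<alpha> S f t) \<le> K * B"
    by (rule Pconv_bound[of r]) (rule that, assumption, simp)
  note reg' = reg[unfolded regular_def]
  have cauF: "uniformly_Cauchy_on {0..r} F"
    using lim uniformly_convergent_Cauchy uniformly_convergent_on_def by blast
  have "uniformly_Cauchy_on {0..r} H"
    unfolding uniformly_Cauchy_on_def
  proof (intro allI impI)
    fix e :: real assume e: "0 < e"
    define \<epsilon> where "\<epsilon> = e / (C + 2)"
    have \<epsilon>: "0 < \<epsilon>" using e C by (simp add: \<epsilon>_def)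
    obtain N where N: "\<And>t m n. t \<in> {0..r} \<Longrightarrow> N \<le> m \<Longrightarrow> N \<le> n \<Longrightarrow> dist (F m t) (F n t) < \<epsilon>"
      using cauF \<epsilon> unfolding uniformly_Cauchy_on_def by metis
    have "dist (H m t) (H n t) < e" if t: "t \<in> {0..r}" and mn: "N \<le> m" "N \<le> n" for t m n
    proof -
      let ?d = "\<lambda>s. F m s - F n s"
      have d: "continuous_on {0..r} ?d" by (intro continuous_on_diff F)
      have P: "Pconv \<alpha> S ?d t = gconv \<alpha> (H m) t - gconv \<alpha> (H n) t"
        using Pconv_diff[OF t F F] reg' t by simp
      then have PD: "Pconv \<alpha> S ?d t \<in> D" using reg' t by (auto intro: subspace_diff[OF D_subspace])
      have "A (Pconv \<alpha> S ?d t) = (H m t - F m t) - (H n t - F n t)"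
        unfolding P using reg' t by (simp add: A_diff)
      then have "H m t - H n t = A (Pconv \<alpha> S ?d t) + ?d t" by simp
      then have "norm (H m t - H n t) \<le> norm (A (Pconv \<alpha> S ?d t)) + norm (?d t)"
        by (metis norm_triangle_ineq)
      moreover have "norm (A (Pconv \<alpha> S ?d t)) \<le> C * \<epsilon>"
        by (rule C(2)[OF t d \<epsilon> _ PD]) (use N mn in \<open>auto simp: dist_norm intro: less_imp_le\<close>)
      moreover have "norm (?d t) < \<epsilon>" using N[OF t mn] by (simp add: dist_norm)
      ultimately have "norm (H m t - H n t) < (C + 2) * \<epsilon>" using \<epsilon> by (simp add: algebra_simps)
      then show ?thesis using C by (simp add: \<epsilon>_def dist_norm)
    qed
    then show "\<exists>M. \<forall>x\<in>{0..r}. \<forall>m\<ge>M. \<forall>n\<ge>M. dist (H m x) (H n x) < e" by blast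
  qed
  then obtain h where h: "uniform_limit {0..r} H h sequentially"
    using Cauchy_uniformly_convergent uniformly_convergent_on_def by blast
  have cH: "continuous_on {0..r} (H n)" for n using reg' by blast
  have ch: "continuous_on {0..r} h"
    by (rule uniform_limit_theorem[OF _ h]) (auto intro: always_eventually cH)
  have gl: "uniform_limit {0..r} (\<lambda>n. gconv \<alpha> (H n)) (gconv \<alpha> h) sequentially"
    using gconv_uniform_limit[OF _ cH ch h] \<alpha> by simp
  have "Pconv \<alpha> S f t = gconv \<alpha> h t \<and> gconv \<alpha> h t \<in> D \<and> A (gconv \<alpha> h t) = h t - f t"
    if t: "t \<in> {0..r}" for t
  proof -
    have g1: "(\<lambda>n. gconv \<alpha> (H n) t) \<longlonglongrightarrow> gconv \<alpha> h t" by (rule tendsto_uniform_limitI[OF gl t])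
    have "(\<lambda>n. H n t - F n t) \<longlonglongrightarrow> h t - f t"
      by (intro tendsto_diff tendsto_uniform_limitI[OF h t] tendsto_uniform_limitI[OF lim t])
    then have "(\<lambda>n. A (gconv \<alpha> (H n) t)) \<longlonglongrightarrow> h t - f t" using reg' t by simp
    then have "gconv \<alpha> h t \<in> D \<and> A (gconv \<alpha> h t) = h t - f t"
      using closed_op_limit[OF A _ g1] reg' t by blast
    \<comment> \<open>The same sequence is P * F n, which converges to P * f by
      \<open>Pconv_bound\<close>; comparing both limits gives P * f = g_\<alpha> * h.\<close>
    moreover have "(\<lambda>n. gconv \<alpha> (H n) t) \<longlonglongrightarrow> Pconv \<alpha> S f t"
    proof (rule tendstoI)
      fix e :: real assume e: "0 < e"
      then have "\<forall>\<^sub>F n in sequentially. \<forall>s\<in>{0..r}. dist (F n s) (f s) < e / (2 * K)"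
        using lim K(1) by (auto simp: uniform_limit_iff)
      then show "\<forall>\<^sub>F n in sequentially. dist (gconv \<alpha> (H n) t) (Pconv \<alpha> S f t) < e"
      proof eventually_elim
        case (elim n)
        have "norm (Pconv \<alpha> S (\<lambda>s. F n s - f s) t) \<le> K * (e / (2 * K))"
          by (rule K(2)[OF t continuous_on_diff[OF F f]])
             (use elim in \<open>auto simp: dist_norm intro: less_imp_le\<close>)
        then show ?case
          using Pconv_diff[OF t F f] reg' t K(1) e by (simp add: dist_norm)
      qed
    qed
    then have "gconv \<alpha> h t = Pconv \<alpha> S f t" by (rule LIMSEQ_unique[OF g1])
    ultimately show ?thesis by simp
  qed
  then show ?thesis using ch unfolding regular_def by blast
qed

lemma bounded_semivariation_imp_regular:
  assumes sv: "bounded_semivariation S 0 r" and r: "0 < r" and f: "continuous_on {0..r} f"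
  shows "\<exists>h. regular r f h"
  using r f
proof (induction rule: continuous_monomial_induct)
  case (monomial k x)
  show ?case by (rule regular_monomial)
next
  case (add f g)
  then show ?case using regular_add by blast
next
  case (limit F f)
  then obtain H where "\<And>n. regular r (F n) (H n)" by metis
  then show ?case using regular_limit[OF sv] limit by blast
qed

text \<open>All three terms merge into u = x + t y + g_\<alpha> * H, where H is the Caputo
  derivative of u. The semigroup law yields u' = y + g_(\<alpha>-1) * H and g_(2-\<alpha>) * (u - x
  - t y) = g_2 * H, whose second derivative is H = A u + f.\<close>

lemma regular_imp_strong_solution:
  assumes f: "regular r f h" and fc: "continuous_on {0..r} f" and x: "x \<in> D" and y: "y \<in> D"
  shows "strong_solution D A \<alpha> r f x y (\<lambda>t. S t x + integral {0..t} (\<lambda>s. S s y) + Pconv \<alpha> S f t)"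
proof -
  note reg = f[unfolded regular_def]
  define u where "u t = S t x + integral {0..t} (\<lambda>s. S s y) + Pconv \<alpha> S f t" for t
  define Y where "Y s = gconv 1 (\<lambda>\<tau>. S \<tau> (A y)) s" for s
  define H where "H s = S s (A x) + Y s + h s" for s
  have cY: "continuous_on {0..b} Y" for b
    unfolding Y_def by (intro gconv_continuous S_interval_continuous) simp
  have cH: "continuous_on {0..r} H"
    unfolding H_def using reg by (intro continuous_on_add S_interval_continuous cY) auto
  have u: "u t = x + t *\<^sub>R y + gconv \<alpha> H t \<and> u t \<in> D \<and> A (u t) = H t - f t" if t: "t \<in> {0..r}" for t
  proof -
    have t0: "0 \<le> t" using t by simp
    have ch: "continuous_on {0..t} h" using reg t by (auto intro: continuous_on_subset)
    have Sx: "S t x = x + gconv \<alpha> (\<lambda>s. S s (A x)) t" "S t x \<in> D" "A (S t x) = S t (A x)"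
      using S_resolvent S_D t0 x by auto
    have AS: "A (S s y) = S s (A y)" if "s \<in> {0..t}" for s using S_D y that by auto
    have "continuous_on {0..t} (\<lambda>s. A (S s y))"
      by (rule continuous_on_eq[OF S_interval_continuous[of _ "A y"]]) (use AS in auto)
    from closed_op_gconv[OF A _ t0 _ S_interval_continuous this, of 1]
    have "gconv 1 (\<lambda>s. S s y) t \<in> D" "A (gconv 1 (\<lambda>s. S s y) t) = gconv 1 (\<lambda>s. A (S s y)) t"
      using S_D y by auto
    moreover have "gconv 1 (\<lambda>s. A (S s y)) t = Y t"
      unfolding Y_def by (rule gconv_cong) (rule AS)
    ultimately have yD: "gconv 1 (\<lambda>s. S s y) t \<in> D" "A (gconv 1 (\<lambda>s. S s y) t) = Y t" by auto
    have "gconv 1 (\<lambda>s. S s y) t = gconv 1 (\<lambda>s. y + gconv \<alpha> (\<lambda>\<tau>. S \<tau> (A y)) s) t"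
      by (rule gconv_cong) (use S_resolvent y in auto)
    also have "\<dots> = gconv 1 (\<lambda>s. y) t + gconv 1 (gconv \<alpha> (\<lambda>\<tau>. S \<tau> (A y))) t"
      using \<alpha> t0 by (intro gconv_add gconv_continuous S_interval_continuous continuous_on_const) auto
    also have "gconv 1 (\<lambda>s. y) t = t *\<^sub>R y" using t0 by (simp add: gconv_1)
    \<comment> \<open>Commuting g_1 past g_\<alpha> gives the y-term the same outer kernel as the
      other terms.\<close>
    also have "gconv 1 (gconv \<alpha> (\<lambda>\<tau>. S \<tau> (A y))) t = gconv \<alpha> (gconv 1 (\<lambda>\<tau>. S \<tau> (A y))) t"
      using gconv_gconv[of 1 \<alpha> t "\<lambda>\<tau>. S \<tau> (A y)"] gconv_gconv[of \<alpha> 1 t "\<lambda>\<tau>. S \<tau> (A y)"] \<alpha> t0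
      by (simp add: S_interval_continuous add.commute)
    also have "\<dots> = gconv \<alpha> Y t" by (simp add: Y_def[abs_def])
    finally have Iy: "gconv 1 (\<lambda>s. S s y) t = t *\<^sub>R y + gconv \<alpha> Y t" .
    have "gconv \<alpha> H t = gconv \<alpha> (\<lambda>s. S s (A x)) t + gconv \<alpha> Y t + gconv \<alpha> h t"
      unfolding H_def using \<alpha> t0 ch cY by (simp add: gconv_add continuous_on_add S_interval_continuous)
    moreover have ueq: "u t = S t x + gconv 1 (\<lambda>s. S s y) t + gconv \<alpha> h t"
      using reg t by (simp add: u_def gconv_1)
    ultimately have "u t = x + t *\<^sub>R y + gconv \<alpha> H t" using Sx(1) Iy by simp
    moreover have "u t \<in> D"
      unfolding ueq using Sx yD reg t by (intro subspace_add[OF D_subspace]) auto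
    moreover have "A (u t) = H t - f t"
      unfolding ueq using Sx yD reg t by (simp add: A_add subspace_add[OF D_subspace] H_def)
    ultimately show ?thesis by blast
  qed
  have a1: "0 < \<alpha> - 1" "0 < 2 - \<alpha>" using \<alpha> by auto
  have cfH: "continuous_on {0..t} H" if "t \<in> {0..r}" for t
    using cH that by (auto intro: continuous_on_subset)
  have c1: "continuous_on {0..r} (gconv (\<alpha> - 1) H)" by (rule gconv_continuous[OF a1(1) cH])
  have du: "(u has_vector_derivative (y + gconv (\<alpha> - 1) H t)) (at t within {0..r})" if t: "t \<in> {0..r}" for t
  proof -
    have eq: "u s = x + s *\<^sub>R y + integral {0..s} (gconv (\<alpha> - 1) H)" if s: "s \<in> {0..r}" for s
      using gconv_gconv[OF _ a1(1) cfH[OF s], of 1] s u[OF s] by (simp add: gconv_1)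
    have "((\<lambda>t. x + t *\<^sub>R y + integral {0..t} (gconv (\<alpha> - 1) H)) has_vector_derivative
        0 + (t *\<^sub>R 0 + 1 *\<^sub>R y) + gconv (\<alpha> - 1) H t) (at t within {0..r})"
      by (intro has_vector_derivative_add integral_has_vector_derivative[OF c1 t]
          has_vector_derivative_const has_vector_derivative_scaleR DERIV_ident)
    from has_vector_derivative_transform[OF t eq this] show ?thesis by simp
  qed
  have v: "gconv (2 - \<alpha>) (\<lambda>s. u s - x - s *\<^sub>R y) t = integral {0..t} (gconv 1 H)" if t: "t \<in> {0..r}" for t
  proof -
    have "gconv (2 - \<alpha>) (\<lambda>s. u s - x - s *\<^sub>R y) t = gconv (2 - \<alpha>) (gconv \<alpha> H) t"
      by (rule gconv_cong) (use u t in auto)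
    also have "\<dots> = gconv 2 H t"
      using gconv_gconv[OF a1(2) _ cfH[OF t], of \<alpha>] \<alpha> t by simp
    also have "\<dots> = gconv 1 (gconv 1 H) t"
      using gconv_gconv[OF _ _ cfH[OF t], of 1 1] t by simp
    finally show ?thesis by (simp add: gconv_1)
  qed
  have c2: "continuous_on {0..r} (gconv 1 H)" using gconv_continuous[OF _ cH, of 1] by simp
  have dv1: "(gconv (2 - \<alpha>) (\<lambda>s. u s - x - s *\<^sub>R y) has_vector_derivative gconv 1 H t) (at t within {0..r})"
    if t: "t \<in> {0..r}" for t
    by (rule has_vector_derivative_transform[OF t v integral_has_vector_derivative[OF c2 t]])
  have dv2: "(gconv 1 H has_vector_derivative H t) (at t within {0..r})" if t: "t \<in> {0..r}" for t
    using integral_has_vector_derivative[OF cH t] by (simp add: gconv_1[abs_def])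
  show ?thesis
    unfolding u_def[symmetric, abs_def] strong_solution_def
  proof (intro conjI)
    show "\<forall>t\<in>{0..r}. u t \<in> D" using u by blast
    show "continuous_on {0..r} u" by (rule continuous_on_vector_derivative[OF du])
    show "continuous_on {0..r} (\<lambda>t. A (u t))"
      by (rule continuous_on_eq[OF continuous_on_diff[OF cH fc]])
         (simp add: u[THEN conjunct2, THEN conjunct2])
    show "\<exists>u'. (\<forall>t\<in>{0..r}. (u has_vector_derivative u' t) (at t within {0..r})) \<and>
           continuous_on {0..r} u' \<and> u 0 = x \<and> u' 0 = y" 
      by (rule exI[of _ "\<lambda>t. y + gconv (\<alpha> - 1) H t"])
         (use du c1 in \<open>auto intro!: continuous_intros simp: u_def\<close>)
    show "\<exists>v1 v2. (\<forall>t\<in>{0..r}.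
        (gconv (2 - \<alpha>) (\<lambda>s. u s - x - s *\<^sub>R y) has_vector_derivative v1 t) (at t within {0..r}) \<and>
        (v1 has_vector_derivative v2 t) (at t within {0..r})) \<and>
        continuous_on {0..r} v2 \<and> (\<forall>t\<in>{0..r}. v2 t = A (u t) + f t)"
      by (rule exI[of _ "gconv 1 H"], rule exI[of _ H])
         (simp add: dv1 dv2 cH u[THEN conjunct2, THEN conjunct2])
  qed
qed

subsection \<open>Solvability implies bounded semivariation\<close>

lemma Lop_diff:
  assumes "0 \<le> t" "continuous_on {0..t} f" "continuous_on {0..t} g"
  shows "Lop t (\<lambda>s. f s - g s) = Lop t f - Lop t g"
  using Lop_add[OF assms(1,2), of "\<lambda>s. (- 1) *\<^sub>R g s"] Lop_scaleR[of t "- 1" g] assms(3)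
  by (simp add: continuous_on_minus)

lemma Lop_sum:
  assumes "0 \<le> t" "finite I" "\<And>i. i \<in> I \<Longrightarrow> continuous_on {0..t} (g i)"
  shows "Lop t (\<lambda>s. \<Sum>i\<in>I. g i s) = (\<Sum>i\<in>I. Lop t (g i))"
  using assms(2,3)
proof (induction rule: finite_induct)
  case empty
  then show ?case by (simp add: Lop_def)
next
  case (insert i I)
  then have "Lop t (\<lambda>s. g i s + (\<Sum>i\<in>I. g i s)) = Lop t (g i) + Lop t (\<lambda>s. \<Sum>i\<in>I. g i s)"
    using assms(1) by (intro Lop_add continuous_on_sum) auto
  then show ?case using insert by simp
qed

text \<open>The ramp differs from the indicator of \<tau> > c only on [c, c + \<delta>], where the
  integrand is off by at most K * norm z; the indicator itself integrates to Q r z - Q c z.\<close>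

lemma Lop_ramp_tendsto:
  assumes c: "c \<in> {0..r}"
  shows "(\<lambda>m. Lop r (\<lambda>\<tau>. ramp (inverse (real (Suc m))) (\<tau> - c) *\<^sub>R z)) \<longlonglongrightarrow> Q r z - Q c z"
proof -
  obtain K where K: "0 < K" "\<And>t x. t \<in> {0..r} \<Longrightarrow> norm (Pop \<alpha> S t x) \<le> K * norm x"
    by (rule Pop_bound[of r]) (rule that, assumption, simp)
  have bd: "norm (Lop r (\<lambda>\<tau>. ramp \<delta> (\<tau> - c) *\<^sub>R z) - (Q r z - Q c z)) \<le> K * norm z * \<delta>" if \<delta>: "0 < \<delta>" for \<delta>
  proof -
    \<comment> \<open>Capped at r because c + \<delta> may lie beyond the interval, for instance
      when c = r.\<close>
    define e where "e = min r (c + \<delta>)"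
    have e: "c \<le> e" "e \<le> r" "e - c \<le> \<delta>" "0 \<le> c" "c \<le> r" using c \<delta> by (auto simp: e_def)
    let ?h = "\<lambda>\<tau>. Pop \<alpha> S \<tau> (ramp \<delta> (\<tau> - c) *\<^sub>R z)"
    let ?k = "\<lambda>\<tau>. ?h \<tau> - Pop \<alpha> S \<tau> z"
    have ch: "continuous_on {0..r} ?h"
      by (intro Pop_apply_continuous continuous_intros)
    have ck: "continuous_on {0..r} ?k"
      by (intro continuous_on_diff ch Pop_continuous)
    have int: "?k integrable_on {a..b}" "?h integrable_on {a..b}" "(\<lambda>\<tau>. Pop \<alpha> S \<tau> z) integrable_on {a..b}"
      if "0 \<le> a" "b \<le> r" for a b
    proof -
      have "{a..b} \<subseteq> {0..r}" using that by auto
      then show "?k integrable_on {a..b}" "?h integrable_on {a..b}" "(\<lambda>\<tau>. Pop \<alpha> S \<tau> z) integrable_on {a..b}"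
        using integrable_continuous_real continuous_on_subset ck ch Pop_continuous[of r z] by blast+
    qed
    have "Lop r (\<lambda>\<tau>. ramp \<delta> (\<tau> - c) *\<^sub>R z) = integral {0..c} ?h + integral {c..r} ?h"
      unfolding Lop_def using e int by (intro Henstock_Kurzweil_Integration.integral_combine[symmetric]) auto
    also have "integral {0..c} ?h = 0"
      by (rule integral_unique, rule has_integral_is_0) (use \<delta> in \<open>simp add: ramp_eq_0\<close>)
    finally have "Lop r (\<lambda>\<tau>. ramp \<delta> (\<tau> - c) *\<^sub>R z) - (Q r z - Q c z) = integral {c..r} ?k"
      using e int by (simp add: integral_Pop[symmetric] integral_diff)
    also have "\<dots> = integral {c..e} ?k + integral {e..r} ?k"
      using e int by (intro Henstock_Kurzweil_Integration.integral_combine[symmetric]) auto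
    also have "integral {e..r} ?k = 0"
    proof (cases "e = r")
      case False
      then have "e = c + \<delta>" by (auto simp: e_def)
      then show ?thesis
        by (intro integral_unique has_integral_is_0) (use \<delta> in \<open>simp add: ramp_eq_1\<close>)
    qed simp
    finally have "norm (Lop r (\<lambda>\<tau>. ramp \<delta> (\<tau> - c) *\<^sub>R z) - (Q r z - Q c z)) = norm (integral {c..e} ?k)"
      by simp
    also have "\<dots> \<le> K * norm z * (e - c)"
    proof (rule integral_bound[OF e(1)])
      show "continuous_on {c..e} ?k" by (rule continuous_on_subset[OF ck]) (use e in auto)
      fix \<tau> assume "\<tau> \<in> {c..e}"
      then have \<tau>: "\<tau> \<in> {0..r}" using e by auto
      have "?k \<tau> = Pop \<alpha> S \<tau> ((ramp \<delta> (\<tau> - c) - 1) *\<^sub>R z)"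
        using \<tau> by (simp add: Pop_diff Pop_scaleR scaleR_diff_left)
      also have "norm \<dots> \<le> K * norm ((ramp \<delta> (\<tau> - c) - 1) *\<^sub>R z)" by (rule K(2)[OF \<tau>])
      also have "\<dots> \<le> K * norm z"
        using ramp_range[of \<delta> "\<tau> - c"] K(1) by (intro mult_left_mono) (auto simp: mult_left_le_one_le)
      finally show "norm (?k \<tau>) \<le> K * norm z" .
    qed
    also have "\<dots> \<le> K * norm z * \<delta>" using e K(1) by (intro mult_left_mono) auto
    finally show ?thesis .
  qed
  have "(\<lambda>m. Lop r (\<lambda>\<tau>. ramp (inverse (real (Suc m))) (\<tau> - c) *\<^sub>R z) - (Q r z - Q c z)) \<longlonglongrightarrow> 0"
  proof (rule Lim_null_comparison)
    show "\<forall>\<^sub>F m in sequentially. norm (Lop r (\<lambda>\<tau>. ramp (inverse (real (Suc m))) (\<tau> - c) *\<^sub>R z) - (Q r z - Q c z))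
        \<le> K * norm z * inverse (real (Suc m))"
      by (intro always_eventually allI bd) simp
    show "(\<lambda>m. K * norm z * inverse (real (Suc m))) \<longlonglongrightarrow> 0"
      by (intro tendsto_mult_right_zero LIMSEQ_inverse_real_of_nat)
  qed
  then show ?thesis by (simp only: LIM_zero_iff)
qed

text \<open>Each weight is a difference of two ramps, and the terms Q r (xs i) in their limits
  cancel.\<close>

lemma Lop_ramp_step_tendsto:
  assumes r: "0 \<le> r" and d: "subdivision 0 r d n"
  shows "(\<lambda>m. Lop r (ramp_step (inverse (real (Suc m))) d n xs)) \<longlonglongrightarrow>
    (\<Sum>i\<in>{1..n}. Q (d i) (xs i) - Q (d (i - 1)) (xs i))"
proof -
  have "Lop r (ramp_step \<delta> d n xs) = (\<Sum>i\<in>{1..n}. Lop r (\<lambda>\<tau>. ramp \<delta> (\<tau> - d (i - 1)) *\<^sub>R xs i)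
      - Lop r (\<lambda>\<tau>. ramp \<delta> (\<tau> - d i) *\<^sub>R xs i))" for \<delta>
  proof -
    have "Lop r (ramp_step \<delta> d n xs)
        = (\<Sum>i\<in>{1..n}. Lop r (\<lambda>\<tau>. (ramp \<delta> (\<tau> - d (i - 1)) - ramp \<delta> (\<tau> - d i)) *\<^sub>R xs i))"
      unfolding ramp_step_def[abs_def] by (intro Lop_sum r continuous_intros) auto
    also have "\<dots> = (\<Sum>i\<in>{1..n}. Lop r (\<lambda>\<tau>. ramp \<delta> (\<tau> - d (i - 1)) *\<^sub>R xs i)
      - Lop r (\<lambda>\<tau>. ramp \<delta> (\<tau> - d i) *\<^sub>R xs i))"
      unfolding scaleR_diff_left by (intro sum.cong refl Lop_diff r continuous_intros)
    finally show ?thesis .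
  qed
  moreover have "(\<lambda>m. \<Sum>i\<in>{1..n}. Lop r (\<lambda>\<tau>. ramp (inverse (real (Suc m))) (\<tau> - d (i - 1)) *\<^sub>R xs i)
      - Lop r (\<lambda>\<tau>. ramp (inverse (real (Suc m))) (\<tau> - d i) *\<^sub>R xs i)) \<longlonglongrightarrow>
      (\<Sum>i\<in>{1..n}. (Q r (xs i) - Q (d (i - 1)) (xs i)) - (Q r (xs i) - Q (d i) (xs i)))"
    by (intro tendsto_sum tendsto_diff[OF Lop_ramp_tendsto Lop_ramp_tendsto] subdivision_range[OF d]) auto
  ultimately show ?thesis by simp
qed

text \<open>The uniform boundedness principle, applied to the operators Aapprox composed with
  convolution at time r, replaces an appeal to the closed graph theorem.\<close>

lemma Lop_D_imp_Aapprox_bound: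
  assumes r: "0 \<le> r" and LD: "\<And>g. continuous_on {0..r} g \<Longrightarrow> Lop r g \<in> D"
  shows "\<exists>C. \<forall>n g. continuous_on UNIV g \<longrightarrow> (\<forall>s. norm (g s) \<le> 1) \<longrightarrow>
    norm (Aapprox (inverse (real (Suc n))) (Lop r g)) \<le> C"
proof -
  obtain K where K: "0 < K"
    "\<And>t g B. t \<in> {0..r} \<Longrightarrow> continuous_on {0..t} g \<Longrightarrow> (\<And>s. s \<in> {0..t} \<Longrightarrow> norm (g s) \<le> B)
      \<Longrightarrow> norm (Lop t g) \<le> K * B"
    by (rule Lop_bound[of r]) (rule that, assumption, simp)
  \<comment> \<open>Bounded continuous functions on the whole line form a Banach space type with the
    supremum norm, as uniform boundedness requires; \<open>Lop r\<close> reads only their values on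
    [0,r].\<close>
  define \<Lambda> where "\<Lambda> (g :: real \<Rightarrow>\<^sub>C 'a) = Lop r (apply_bcontfun g)" for g
  have "bounded_linear \<Lambda>"
  proof (rule bounded_linear_intro)
    fix g k :: "real \<Rightarrow>\<^sub>C 'a" and c :: real
    have "apply_bcontfun (g + k) = (\<lambda>s. g s + k s)" by (simp add: plus_bcontfun.rep_eq fun_eq_iff)
    then show "\<Lambda> (g + k) = \<Lambda> g + \<Lambda> k"
      using r by (simp add: \<Lambda>_def Lop_add)
    have "apply_bcontfun (c *\<^sub>R g) = (\<lambda>s. c *\<^sub>R g s)" by (simp add: scaleR_bcontfun.rep_eq fun_eq_iff)
    then show "\<Lambda> (c *\<^sub>R g) = c *\<^sub>R \<Lambda> g" by (simp add: \<Lambda>_def Lop_scaleR)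
    show "norm (\<Lambda> g) \<le> norm g * K"
      using K(2)[of r "apply_bcontfun g" "norm g"] r by (simp add: \<Lambda>_def norm_bounded mult.commute)
  qed
  then have \<Lambda>: "blinfun_apply (Blinfun \<Lambda>) = \<Lambda>" by (rule bounded_linear_Blinfun_apply)
  define T where "T n = Aapprox (inverse (real (Suc n))) o\<^sub>L Blinfun \<Lambda>" for n
  \<comment> \<open>Here the assumption \<open>LD\<close> enters: \<open>Lop r g\<close> lies in D,
    so the approximations converge to its image under A and are bounded along n.\<close>
  have "\<exists>C. \<forall>n\<in>UNIV. norm (T n g) \<le> C" for g
  proof -
    have "Lop r (apply_bcontfun g) \<in> D" by (rule LD) simp
    from Aapprox_tendsto[OF this] have "Bseq (\<lambda>n. T n g)"
      by (intro convergent_imp_Bseq convergentI) (simp add: T_def \<Lambda> \<Lambda>_def)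
    then show ?thesis by (auto simp: Bseq_def)
  qed
  then obtain C where C: "\<And>n. norm (T n) \<le> C"
    using uniform_boundedness_principle[of UNIV T] by blast
  have "norm (Aapprox (inverse (real (Suc n))) (Lop r g)) \<le> C"
    if g: "continuous_on UNIV g" "\<And>s. norm (g s) \<le> 1" for n g
  proof -
    have "g \<in> bcontfun" using g by (auto simp: bcontfun_def bounded_iff)
    then obtain k where k: "g = apply_bcontfun k" by (rule bcontfunE)
    have "norm k \<le> 1" by (rule norm_bound) (use g(2) k in simp)
    have "norm (T n k) \<le> norm (T n) * norm k" by (rule norm_blinfun)
    also have "\<dots> \<le> C * 1" using C[of n] \<open>norm k \<le> 1\<close> norm_ge_zero[of "T n"] norm_ge_zero[of k] by (intro mult_mono) linarith+
    finally show ?thesis by (simp add: T_def \<Lambda> \<Lambda>_def k)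
  qed
  then show ?thesis by blast
qed

text \<open>The sum of increments is A q, where q is the limit of \<open>Lop r\<close> on ramp steps
  of norm at most 1. A need not be continuous, so the ramps are refined under a fixed
  \<open>Aapprox\<close>, and A q is reached afterwards from q in D. C depends neither on the
  subdivision nor on the vectors.\<close>

lemma Lop_D_imp_bounded_semivariation:
  assumes r: "0 \<le> r" and LD: "\<And>g. continuous_on {0..r} g \<Longrightarrow> Lop r g \<in> D"
  shows "bounded_semivariation S 0 r"
proof -
  from Lop_D_imp_Aapprox_bound[OF r LD] obtain C where
    "\<forall>n g. continuous_on UNIV g \<longrightarrow> (\<forall>s. norm (g s) \<le> 1) \<longrightarrow>
      norm (Aapprox (inverse (real (Suc n))) (Lop r g)) \<le> C" by auto
  note C = this[rule_format]
  have "norm (\<Sum>i\<in>{1..n}. blinfun_apply (S (d i) - S (d (i - 1))) (xs i)) \<le> C"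
    if d: "subdivision 0 r d n" and xs: "\<And>i. norm (xs i) \<le> 1" for d n and xs :: "nat \<Rightarrow> 'a"
  proof -
    define q where "q = (\<Sum>i\<in>{1..n}. Q (d i) (xs i) - Q (d (i - 1)) (xs i))"
    have inc: "Q (d i) (xs i) - Q (d (i - 1)) (xs i) \<in> D"
      "A (Q (d i) (xs i) - Q (d (i - 1)) (xs i)) = blinfun_apply (S (d i) - S (d (i - 1))) (xs i)"
      if "i \<in> {1..n}" for i
    proof -
      have "0 \<le> d i" "0 \<le> d (i - 1)"
        using subdivision_range[OF d, of i] subdivision_range[OF d, of "i - 1"] that by auto
      then show "Q (d i) (xs i) - Q (d (i - 1)) (xs i) \<in> D"
        "A (Q (d i) (xs i) - Q (d (i - 1)) (xs i)) = blinfun_apply (S (d i) - S (d (i - 1))) (xs i)"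
        using Q_D by (auto simp: A_diff subspace_diff[OF D_subspace] blinfun.diff_left)
    qed
    have qD: "q \<in> D"
      unfolding q_def by (rule A_sum(1)) (use inc in auto)
    have Aq: "A q = (\<Sum>i\<in>{1..n}. blinfun_apply (S (d i) - S (d (i - 1))) (xs i))"
      unfolding q_def by (subst A_sum(2)) (use inc in \<open>auto intro: sum.cong\<close>)
    have "norm (Aapprox (inverse (real (Suc k))) q) \<le> C" for k
    proof (rule LIMSEQ_le_const2)
      show "(\<lambda>m. norm (Aapprox (inverse (real (Suc k))) (Lop r (ramp_step (inverse (real (Suc m))) d n xs))))
          \<longlonglongrightarrow> norm (Aapprox (inverse (real (Suc k))) q)"
        unfolding q_def by (intro tendsto_intros Lop_ramp_step_tendsto r d)
      show "\<exists>N. \<forall>m\<ge>N. norm (Aapprox (inverse (real (Suc k))) (Lop r (ramp_step (inverse (real (Suc m))) d n xs))) \<le> C"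
        by (intro exI allI impI C ramp_step_continuous norm_ramp_step_le[OF _ d xs]) simp
    qed
    then have "norm (A q) \<le> C"
      by (intro LIMSEQ_le_const2[OF tendsto_norm[OF Aapprox_tendsto[OF qD]]]) blast
    then show ?thesis by (simp add: Aq)
  qed
  then have "SV S 0 r \<le> ereal C"
    unfolding SV_def SV_d_def by (auto intro!: SUP_least)
  then show ?thesis by (auto simp: bounded_semivariation_def)
qed

end

theorem theorem3p5:
  fixes \<alpha> r :: real
    and D :: "'a::banach set"
    and A :: "'a \<Rightarrow> 'a"
    and S :: "real \<Rightarrow> 'a \<Rightarrow>\<^sub>L 'a"
  assumes "1 < \<alpha>" and "\<alpha> < 2"
    and "closed_dense_op D A"
    and "resolvent_family D A \<alpha> S"
    and "0 < r"
  shows "(\<forall>x\<in>D. \<forall>y\<in>D. \<forall>f. continuous_on {0..r} f \<longrightarrow>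
            strong_solution D A \<alpha> r f x y
              (\<lambda>t. S t x + integral {0..t} (\<lambda>s. S s y) + Pconv \<alpha> S f t))
         \<longleftrightarrow> bounded_semivariation S 0 r"
proof -
  interpret resolvent_generator \<alpha> D A S by unfold_locales (use assms in auto)
  show ?thesis
  proof
    assume sol: "\<forall>x\<in>D. \<forall>y\<in>D. \<forall>f. continuous_on {0..r} f \<longrightarrow>
            strong_solution D A \<alpha> r f x y
              (\<lambda>t. S t x + integral {0..t} (\<lambda>s. S s y) + Pconv \<alpha> S f t)"
    \<comment> \<open>Zero initial data leave u = P * f. With f equal to g reversed in time, u r is
      \<open>Lop r g\<close>, and strong solutions take values in D.\<close>
    have "Lop r g \<in> D" if g: "continuous_on {0..r} g" for g
    proof -
      have c: "continuous_on {0..r} (\<lambda>s. g (r - s))"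
        by (rule reflect_continuous[OF g]) (use assms(5) in simp)
      have "0 \<in> D" by (rule subspace_0[OF D_subspace])
      then have "strong_solution D A \<alpha> r (\<lambda>s. g (r - s)) 0 0
          (\<lambda>t. S t 0 + integral {0..t} (\<lambda>s. S s 0) + Pconv \<alpha> S (\<lambda>s. g (r - s)) t)"
        using sol c by blast
      then have "Pconv \<alpha> S (\<lambda>s. g (r - s)) r \<in> D"
        using assms(5) by (simp add: strong_solution_def)
      then show ?thesis using Pconv_eq_Lop[OF c] by simp
    qed
    then show "bounded_semivariation S 0 r"
      using assms(5) by (intro Lop_D_imp_bounded_semivariation) auto
  next
    assume "bounded_semivariation S 0 r"
    then show "\<forall>x\<in>D. \<forall>y\<in>D. \<forall>f. continuous_on {0..r} f \<longrightarrow>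
            strong_solution D A \<alpha> r f x y
              (\<lambda>t. S t x + integral {0..t} (\<lambda>s. S s y) + Pconv \<alpha> S f t)"
      using bounded_semivariation_imp_regular[OF _ assms(5)] regular_imp_strong_solution by meson
  qed
qed

end
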